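(* There exists a unique $r\in(\rho,1)$ such that the equation $\mathcal{R}_r\mathcal{D}=r^2\mathcal{D}$ has a solution $\mathcal{D}\in\mathcal{M}_S$.
   Context: Let $q_0=(\tfrac12,\tfrac{\sqrt3}{2})$, $q_1=(0,0)$, $q_2=(1,0)$, $\rho=\frac{\sqrt5-1}{2}$, $F_0(x)=\rho^2(x-q_0)+q_0$, $F_1(x)=\rho(x-q_1)+q_1$, $F_2(x)=\rho(x-q_2)+q_2$. For a finite word $w$ over $\{0,1,2\}$, $|w|$ is its length and $F_w=F_{w_1}\circ\cdots\circ F_{w_{|w|}}$. $W_1$ is a set of words of the form $w_1\cdots w_n0$ ($n\ge0$, $w_i\in\{1,2\}$) containing exactly one word for each distinct map $F_w$ of this form. $V_0=\{q_0,q_1,q_2\}$, $V_1=\bigcup_{w\in W_1}F_wV_0$. $\mathcal{M}$ is the set of forms $\mathcal{D}(f,g)=\frac12\sum_{i,j}a_{ij}(f(q_i)-f(q_j))(g(q_i)-g(q_j))$ on functions on $V_0$ with $(a_{ij})$ symmetric, $a_{ii}=0$, $a_{ij}\ge0$ and irreducible; $\mathcal{M}_S$ is the subset with $a_{01}=a_{02}$. $\Psi_r\mathcal{D}(f,g)=\sum_{w\in W_1}r^{-|w|+1}\mathcal{D}(f\circ F_w,g\circ F_w)$ on $\mathrm{Dom}(\Psi_r\mathcal{D})=\{f:V_1\to\mathbb{R}:\Psi_r\mathcal{D}(f,f)<\infty\}$, and for $\rho<r<1$, $\mathcal{R}_r\mathcal{D}(u)=\inf\{\Psi_r\mathcal{D}(f):f\in\mathrm{Dom}(\Psi_r\mathcal{D}),f|_{V_0}=u\}$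 for $u:V_0\to\mathbb{R}$.
   Formalization: Since q_1 and q_2 do not lie in V_1, the condition f|_{V_0}=u is read as f(q_0)=u(q_0) and f(x)→u(q_i) as x→q_i within V_1 for i=1,2; these limits exist for every f of finite energy. *)

theory Defs
  imports "HOL-Analysis.Analysis"
begin

text \<open>Points of the plane are represented as complex numbers.
  Vertices q 0, q 1, q 2 of the unit equilateral triangle.\<close>
definition q :: "nat \<Rightarrow> complex" where
  "q i = (if i = 0 then Complex (1/2) (sqrt 3 / 2) else if i = 1 then 0 else 1)"

definition rho :: real where
  "rho = (sqrt 5 - 1) / 2"

definition ratio :: "nat \<Rightarrow> real" where
  "ratio i = (if i = 0 then rho ^ 2 else rho)"

definition F :: "nat \<Rightarrow> complex \<Rightarrow> complex" where
  "F i x = complex_of_real (ratio i) * (x - q i) + q i"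

definition Fw :: "nat list \<Rightarrow> complex \<Rightarrow> complex" where
  "Fw w = foldr (\<lambda>i g. F i \<circ> g) w id"

definition Wform :: "nat list set" where
  "Wform = {ws @ [0] | ws. set ws \<subseteq> {1, 2}}"

definition is_W1 :: "nat list set \<Rightarrow> bool" where
  "is_W1 W \<longleftrightarrow> W \<subseteq> Wform \<and> (\<forall>v\<in>Wform. \<exists>w\<in>W. Fw w = Fw v)
      \<and> (\<forall>w\<in>W. \<forall>w'\<in>W. Fw w = Fw w' \<longrightarrow> w = w')"

definition W1 :: "nat list set" where
  "W1 = (SOME W. is_W1 W)"

definition V0 :: "complex set" where
  "V0 = q ` {0, 1, 2}"

definition V1 :: "complex set" where
  "V1 = (\<Union>w\<in>W1. Fw w ` V0)"

text \<open>The form D(f,g) associated with the coefficient matrix a; functions on V0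
  are represented as functions on the indices 0,1,2 (f i = f(q i)).\<close>
definition Dform :: "(nat \<Rightarrow> nat \<Rightarrow> real) \<Rightarrow> (nat \<Rightarrow> real) \<Rightarrow> (nat \<Rightarrow> real) \<Rightarrow> real" where
  "Dform a f g = 1/2 * (\<Sum>i<3. \<Sum>j<3. a i j * (f i - f j) * (g i - g j))"

definition irreducible3 :: "(nat \<Rightarrow> nat \<Rightarrow> real) \<Rightarrow> bool" where
  "irreducible3 a \<longleftrightarrow> \<not> (\<exists>S. S \<noteq> {} \<and> S \<subset> {0,1,2} \<and>
      (\<forall>i\<in>S. \<forall>j\<in>{0,1,2} - S. a i j = 0))"

definition inM :: "(nat \<Rightarrow> nat \<Rightarrow> real) \<Rightarrow> bool" where
  "inM a \<longleftrightarrow> (\<forall>i<3. \<forall>j<3. a i j = a j i) \<and> (\<forall>i<3. a i i = 0)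
      \<and> (\<forall>i<3. \<forall>j<3. a i j \<ge> 0) \<and> irreducible3 a"

definition inMS :: "(nat \<Rightarrow> nat \<Rightarrow> real) \<Rightarrow> bool" where
  "inMS a \<longleftrightarrow> inM a \<and> a 0 1 = a 0 2"

definition psi_term :: "real \<Rightarrow> (nat \<Rightarrow> nat \<Rightarrow> real) \<Rightarrow> (complex \<Rightarrow> real) \<Rightarrow> nat list \<Rightarrow> real" where
  "psi_term r a f w = r powr (1 - real (length w)) *
      Dform a (\<lambda>i. f (Fw w (q i))) (\<lambda>i. f (Fw w (q i)))"

definition Psi :: "real \<Rightarrow> (nat \<Rightarrow> nat \<Rightarrow> real) \<Rightarrow> (complex \<Rightarrow> real) \<Rightarrow> real" where
  "Psi r a f = infsum (psi_term r a f) W1"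

text \<open>Dom(Psi_r D): functions (only their values on V1 matter) with finite energy
  (the summands are nonnegative, so summability = finiteness).\<close>
definition DomPsi :: "real \<Rightarrow> (nat \<Rightarrow> nat \<Rightarrow> real) \<Rightarrow> (complex \<Rightarrow> real) set" where
  "DomPsi r a = {f. psi_term r a f summable_on W1}"

text \<open>f restricted to V0 equals u: at a vertex lying in V1 this is the value,
  at a vertex that is only an accumulation point of V1 it is the limit along V1.\<close>
definition restricts_to :: "(complex \<Rightarrow> real) \<Rightarrow> (nat \<Rightarrow> real) \<Rightarrow> bool" where
  "restricts_to f u \<longleftrightarrow> (\<forall>i<3. (q i \<in> V1 \<longrightarrow> f (q i) = u i) \<and>
      (f \<longlongrightarrow> u i) (at (q i) within V1))"

definition Rr :: "real \<Rightarrow> (nat \<Rightarrow> nat \<Rightarrow> real) \<Rightarrow> (nat \<Rightarrow> real) \<Rightarrow> real" where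
  "Rr r a u = Inf {Psi r a f | f. f \<in> DomPsi r a \<and> restricts_to f u}"

end

(*
The set V1 is a graded planar graph: the apex of the cell F_w with |w| = n + 1 is
rho^n q_0 + b for a position b in a finite set B n, and its two other vertices are apexes of
level n + 1.  By reflection symmetry a symmetric form is determined by t = a_12 / a_01, and its
renormalization by the two traces P(r,t), Q(r,t) at the boundary values (1,0,0) and (0,1,-1); the
equation R_r D = l D becomes P = 2 l, Q = (2 + 4 t) l.

For fixed r an eigenform exists by the intermediate value theorem in t, because Q >= P at t = 0
(replace f by 1 - |f|) while Q grows in t with arbitrarily small slope (test with affine functions
cut off on the upper levels).  Monotonicity of R_r gives a Collatz-Wielandt bound for the eigenvalue
l(r), so l is antitone, and it is continuous as soon as P and Q are continuous in r.  The latter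
holds since a function of finite energy for r' may be replaced, below a level carrying little energy,
by the linear interpolation of its values on that level, which has finite energy for every r > rho.
As r^2 is strictly increasing, l(r) = r^2 has at most one solution; one exists because
l(31/50) >= (31/50)^2 (Thomson's principle with an explicit flow) and l(9/10) <= (9/10)^2.
*)
theory Submission
  imports Defs
begin

section \<open>Positions of the cells\<close>

text \<open>The range rho < r < 1 has two sources. Level n has at most rho^-(n+2) cells, and an
  affine function changes by order rho^n on each, so its weighted level energies decay like (rho /
  r)^n: for r > rho there are competitors for all boundary values. A chain of edges down to q_1 or
  q_2 has resistance 1 + r + r^2 + ... = 1 / (1 - r), so for r < 1 the values at these corners,
  which are only limits, are felt by the energy. The obstacle is lowering r: the weights then grow
  by the unbounded factors (r' / r)^n, and a competitor for r' may have infinite energy for r. The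
  replacement below a level changes the corner values, and the small affine correction that restores
  them has to be paid for as well. Minimizers never appear: traces are compared by turning
  competitors of one infimum into competitors of another. The endpoint 31/50 lies just above rho.
  There the two edges alone give 2 (1 - r) = 0.76, slightly less than 2 r^2 = 0.7688, so some
  further part of the graph has to be used. At 9/10 there is ample room, and a step function with
  three values suffices.\<close>

lemma rho_pos: "0 < rho" and rho_less_1: "rho < 1"
  and rho_sq: "rho ^ 2 = 1 - rho" and rho_gt: "309 / 500 < rho" and rho_lt: "rho < 31 / 50"
proof -
  have "2236 / 1000 < sqrt 5"
    by (rule real_less_rsqrt) (simp add: power2_eq_square)
  moreover have "sqrt 5 < 224 / 100"
    by (rule real_less_lsqrt) (simp_all add: power2_eq_square)
  ultimately show "0 < rho" "rho < 1" "309 / 500 < rho" "rho < 31 / 50"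
    by (auto simp: rho_def)
  show "rho ^ 2 = 1 - rho"
    by (simp add: rho_def power2_eq_square field_simps)
qed

lemma rho_power_split: "rho ^ n = rho ^ Suc n + rho ^ Suc (Suc n)"
proof -
  have "rho ^ Suc n + rho ^ Suc (Suc n) = rho ^ n * (rho + rho ^ 2)"
    by (simp add: algebra_simps power2_eq_square)
  then show ?thesis by (simp add: rho_sq)
qed

lemma rho_powers:
  "rho ^ 3 = 2 * rho - 1" "rho ^ 4 = 2 - 3 * rho" "rho ^ 5 = 5 * rho - 3"
proof -
  show 3: "rho ^ 3 = 2 * rho - 1"
    using rho_power_split[of 1] rho_sq by (simp add: numeral_eq_Suc)
  show 4: "rho ^ 4 = 2 - 3 * rho"
    using rho_power_split[of 2] rho_sq 3 by (simp add: numeral_eq_Suc)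
  show "rho ^ 5 = 5 * rho - 3"
    using rho_power_split[of 3] 4 3 by (simp add: numeral_eq_Suc)
qed

text \<open>The cells of level n are the images of the triangle under F_w with w = ws 0 and |ws| = n;
  B n collects the horizontal translation parts of the maps F_ws, without repetition.\<close>

fun B :: "nat \<Rightarrow> real set" where
  "B 0 = {0}"
| "B (Suc n) = B n \<union> (\<lambda>b. b + rho ^ (n + 2)) ` B n"

lemma finite_B [simp]: "finite (B n)"
  by (induction n) auto

lemma B_mono_Suc: "b \<in> B n \<Longrightarrow> b \<in> B (Suc n)"
  and B_right_child: "b \<in> B n \<Longrightarrow> b + rho ^ (n + 2) \<in> B (Suc n)"
  by auto

lemma B_mono: "m \<le> n \<Longrightarrow> B m \<subseteq> B n"
  by (rule lift_Suc_mono_le[of B]) auto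

lemma zero_in_B [simp]: "0 \<in> B n"
  by (induction n) auto

lemma B_ge_0: "b \<in> B n \<Longrightarrow> 0 \<le> b"
  using rho_pos by (induction n arbitrary: b) (auto intro!: add_nonneg_nonneg)

lemma top_eq: "1 - rho ^ Suc n = 1 - rho ^ n + rho ^ (n + 2)"
  using rho_power_split[of n] by simp

lemma top_in_B: "1 - rho ^ n \<in> B n"
proof (induction n)
  case (Suc n)
  show ?case
    unfolding top_eq by (rule B_right_child[OF Suc])
qed simp

lemma B_le_top: "b \<in> B n \<Longrightarrow> b \<le> 1 - rho ^ n"
proof (induction n arbitrary: b)
  case (Suc n)
  have "0 < rho ^ (n + 2)" using rho_pos by simp
  then show ?case using Suc unfolding top_eq by fastforce
qed simp

lemma B_reflect: "b \<in> B n \<Longrightarrow> 1 - rho ^ n - b \<in> B n"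
proof (induction n arbitrary: b)
  case (Suc n)
  from Suc.prems consider "b \<in> B n" | c where "c \<in> B n" "b = c + rho ^ (n + 2)"
    by auto
  then show ?case
  proof cases
    case 1
    then have "1 - rho ^ n - b + rho ^ (n + 2) \<in> B (Suc n)"
      using Suc.IH B_right_child by blast
    then show ?thesis
      unfolding top_eq by (simp add: algebra_simps)
  next
    case 2
    then have "1 - rho ^ n - c \<in> B (Suc n)"
      using Suc.IH B_mono_Suc by blast
    then show ?thesis
      unfolding top_eq 2 by (simp add: algebra_simps)
  qed
qed simp

section \<open>Spacing of the positions on one level\<close>

definition separated :: "real \<Rightarrow> real set \<Rightarrow> bool" where
  "separated h X \<longleftrightarrow> (\<forall>x\<in>X. \<forall>y\<in>X. x < y \<longrightarrow> x + h \<le> y)"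

lemma separatedD: "separated h X \<Longrightarrow> x \<in> X \<Longrightarrow> y \<in> X \<Longrightarrow> x < y \<Longrightarrow> x + h \<le> y"
  by (auto simp: separated_def)

text \<open>A packing bound: the intervals [x, x + h) are disjoint and fit between l and u. The
  induction removes the largest point, which becomes the upper end for the others.\<close>

lemma card_separated_le:
  assumes "finite X" "separated h X" "\<And>x. x \<in> X \<Longrightarrow> l \<le> x" "\<And>x. x \<in> X \<Longrightarrow> x + h \<le> u" "l \<le> u"
  shows "real (card X) * h \<le> u - l"
  using assms
proof (induction X arbitrary: u rule: finite_linorder_max_induct)
  case (insert b A)
  have "real (card A) * h \<le> b - l"
  proof (rule insert.IH)
    show "separated h A"
      using insert.prems(1) by (auto simp: separated_def)
    show "x + h \<le> b" if "x \<in> A" for x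
      using insert.hyps(2) that insert.prems(1) by (auto simp: separated_def)
  qed (use insert.prems in auto)
  moreover have "b + h \<le> u" using insert.prems by auto
  moreover have "card (insert b A) = Suc (card A)"
    using insert.hyps by (subst card_insert_disjoint) auto
  ultimately show ?case by (simp add: algebra_simps)
qed simp


text \<open>The gaps follow the Fibonacci substitution: a short gap rho^(n+2) survives as a long gap
  of the next level, and a long gap rho^(n+1) is cut into rho^(n+2) and rho^(n+3). Both claims go
  through one induction, because the separation of new from old positions uses the successors of the
  old ones.\<close>

lemma B_successor_aux:
  "separated (rho ^ (n + 2)) (B n) \<and>
   (\<forall>b\<in>B n. b = 1 - rho ^ n \<or> b + rho ^ (n + 2) \<in> B n \<or> b + rho ^ (n + 1) \<in> B n)"
proof (induction n)
  case 0
  then show ?case by (auto simp: separated_def)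
next
  case (Suc n)
  let ?h = "rho ^ (n + 2)" and ?k = "rho ^ (n + 3)"
  have IH: "\<And>x y. x \<in> B n \<Longrightarrow> y \<in> B n \<Longrightarrow> x < y \<Longrightarrow> x + ?h \<le> y"
    and IH2: "\<And>b. b \<in> B n \<Longrightarrow> b = 1 - rho ^ n \<or> b + ?h \<in> B n \<or> b + rho ^ (n + 1) \<in> B n"
    using Suc by (auto simp: separated_def)
  have split: "rho ^ (n + 1) = ?h + ?k" "?h = ?k + rho ^ (n + 4)"
    using rho_power_split[of "n + 1"] rho_power_split[of "n + 2"] by (simp_all add: eval_nat_numeral)
  have pos: "0 < ?h" "0 < ?k" "0 < rho ^ (n + 4)" using rho_pos by simp_all
  have kh: "?k < ?h" using split pos by linarith
  have sep: "x + ?k \<le> y" if xy: "x \<in> B (Suc n)" "y \<in> B (Suc n)" "x < y" for x y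
  proof -
    \<comment> \<open>An old position against a new one: if c has a successor, then c + h is that
      successor or lies in a long gap of length h + k, at distance k from its right end.\<close>
    have cross: "c + ?h + ?k \<le> b \<or> c + ?h = b \<or> b + ?k \<le> c + ?h" if bc: "b \<in> B n" "c \<in> B n" for b c
    proof (cases "c < b")
      case False
      then show ?thesis using kh by linarith
    next
      case True
      then have "c \<noteq> 1 - rho ^ n"
        using B_le_top[OF bc(1)] by linarith
      then consider "c + ?h \<in> B n" | "c + rho ^ (n + 1) \<in> B n" using IH2 bc by blast
      then show ?thesis
      proof cases
        case 1
        then show ?thesis
          using IH[OF bc(2,1)] IH[OF 1 bc(1)] True kh by linarith
      next
        case 2
        have "c + ?h + ?k \<le> b"
        proof (rule ccontr)
          assume "\<not> ?thesis"
          then have "b + ?h \<le> c + rho ^ (n + 1)"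
            using IH[OF bc(1) 2] split by linarith
          moreover have "c + ?h \<le> b" using IH[OF bc(2,1) True] .
          ultimately show False using split kh by linarith
        qed
        then show ?thesis by simp
      qed
    qed
    from xy(1) consider "x \<in> B n" | c where "c \<in> B n" "x = c + ?h" by auto
    then show ?thesis
    proof cases
      case 1
      from xy(2) consider "y \<in> B n" | c where "c \<in> B n" "y = c + ?h" by auto
      then show ?thesis
      proof cases
        case 1
        then show ?thesis using IH[OF \<open>x \<in> B n\<close> 1] xy(3) kh by linarith
      next
        case (2 c)
        then show ?thesis using cross[OF \<open>x \<in> B n\<close> 2(1)] xy(3) pos by linarith
      qed
    next
      case (2 c)
      note c = 2
      from xy(2) consider "y \<in> B n" | d where "d \<in> B n" "y = d + ?h" by auto
      then show ?thesis
      proof cases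
        case 1
        then show ?thesis using cross[OF 1 c(1)] c xy(3) pos by linarith
      next
        case (2 d)
        then show ?thesis using IH[OF c(1) 2(1)] c xy(3) kh by linarith
      qed
    qed
  qed
  have succ: "b = 1 - rho ^ Suc n \<or> b + ?k \<in> B (Suc n) \<or> b + ?h \<in> B (Suc n)"
    if "b \<in> B (Suc n)" for b
  proof -
    from that consider "b \<in> B n" | c where "c \<in> B n" "b = c + ?h" "b \<notin> B n" by auto
    then show ?thesis
    proof cases
      case 1
      then show ?thesis using B_right_child by blast
    next
      case 2
      then consider "c = 1 - rho ^ n" | "c + rho ^ (n + 1) \<in> B n" using IH2 by blast
      then show ?thesis
      proof cases
        case 1
        then show ?thesis using 2 top_eq by simp
      next
        case 3: 2
        have "b + ?k = c + rho ^ (n + 1)" using 2 split by simp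
        then show ?thesis using 3 B_mono_Suc by metis
      qed
    qed
  qed
  show ?case
    using sep succ by (auto simp: separated_def eval_nat_numeral)
qed

lemma B_separated: "separated (rho ^ (n + 2)) (B n)"
  using B_successor_aux by blast

lemma card_B_le: "real (card (B n)) * rho ^ (n + 2) \<le> 1"
proof -
  have "real (card (B n)) * rho ^ (n + 2) \<le> 1 - 0"
  proof (rule card_separated_le[OF _ B_separated])
    fix x assume "x \<in> B n"
    moreover have "rho ^ (n + 2) \<le> rho ^ n"
      using rho_pos rho_less_1 by (intro power_decreasing) auto
    ultimately show "x + rho ^ (n + 2) \<le> 1" using B_le_top[of x n] by linarith
  qed (auto simp: B_ge_0)
  then show ?thesis by simp
qed

text \<open>At the top position, which has no successor, this returns the default rho^(n+1); a
  positive value keeps divisions by the gap harmless.\<close>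

definition gap :: "nat \<Rightarrow> real \<Rightarrow> real" where
  "gap n b = (if b + rho ^ (n + 2) \<in> B n then rho ^ (n + 2) else rho ^ (n + 1))"

lemma gap_pos: "0 < gap n b"
  using rho_pos by (simp add: gap_def)

lemma gap_ge: "rho ^ (n + 2) \<le> gap n b"
  using rho_pos rho_less_1 by (auto simp: gap_def intro!: power_decreasing)

lemma gap_next:
  assumes "b \<in> B n" "b \<noteq> 1 - rho ^ n"
  shows "b + gap n b \<in> B n"
  using B_successor_aux[of n] assms by (auto simp: gap_def)

lemma gap_least:
  assumes "b \<in> B n" "c \<in> B n" "b < c"
  shows "b + gap n b \<le> c"
proof -
  have 1: "b + rho ^ (n + 2) \<le> c" using B_separated assms by (rule separatedD)
  have "b \<noteq> 1 - rho ^ n" using B_le_top[OF assms(2)] assms(3) by linarith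
  note next_B = gap_next[OF assms(1) this]
  show ?thesis
  proof (cases "b + rho ^ (n + 2) \<in> B n")
    case True
    then show ?thesis using 1 by (simp add: gap_def)
  next
    case False
    then have *: "b + rho ^ (n + 1) \<in> B n" using next_B by (simp add: gap_def)
    show ?thesis
    proof (rule ccontr)
      assume "\<not> ?thesis"
      then have "c < b + rho ^ (n + 1)" using False by (simp add: gap_def)
      then have "c + rho ^ (n + 2) \<le> b + rho ^ (n + 1)"
        by (rule separatedD[OF B_separated assms(2) *])
      \<comment> \<open>A position inside a long gap would leave room for two short ones, that is 2
        rho <= 1.\<close>
      with 1 have "2 * rho ^ (n + 2) \<le> rho ^ (n + 1)" by linarith
      moreover have "rho ^ (n + 1) < 2 * rho ^ (n + 2)"
        using rho_gt by (simp add: field_simps)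
      ultimately show False by linarith
    qed
  qed
qed

text \<open>A freshly inserted position below the top cuts a long gap and is therefore followed by a
  short one. So the ends of a long gap are the two lower vertices of one cell of the preceding
  level, which is how increments over long gaps are estimated later.\<close>

lemma long_gap_parent:
  assumes "b \<in> B (Suc n)" "b \<noteq> 1 - rho ^ Suc n" "b + rho ^ (n + 3) \<notin> B (Suc n)"
  shows "b \<in> B n"
proof (rule ccontr)
  assume "b \<notin> B n"
  then obtain c where c: "c \<in> B n" "b = c + rho ^ (n + 2)" using assms(1) by auto
  have "c \<noteq> 1 - rho ^ n" using c assms(2) top_eq by auto
  moreover have "c + rho ^ (n + 2) \<notin> B n" using c \<open>b \<notin> B n\<close> by simp
  ultimately have "c + rho ^ (n + 1) \<in> B n"
    using B_successor_aux[of n] c by blast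
  moreover have "b + rho ^ (n + 3) = c + rho ^ (n + 1)"
    using c rho_power_split[of "n + 1"] by (simp add: eval_nat_numeral)
  ultimately show False using assms(3) B_mono_Suc by metis
qed

section \<open>Words, cells and energies\<close>

definition apex :: "nat \<Rightarrow> real \<Rightarrow> complex" where
  "apex n b = of_real (rho ^ n) * q 0 + of_real b"

lemma Fw_append: "Fw (u @ v) = Fw u \<circ> Fw v"
  by (induction u) (simp_all add: Fw_def o_assoc)

lemma Fw_Nil [simp]: "Fw [] x = x" and Fw_single: "Fw [i] = F i"
  by (simp_all add: Fw_def fun_eq_iff)

lemma F_1: "F 1 x = of_real rho * x" and F_2: "F 2 x = of_real rho * x + of_real (rho ^ 2)"
  by (simp_all add: F_def ratio_def q_def rho_sq algebra_simps)

lemma F_0_q0: "F 0 (q 0) = q 0" and F_0_q1: "F 0 (q 1) = of_real rho * q 0"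
  and F_0_q2: "F 0 (q 2) = of_real rho * q 0 + of_real (rho ^ 2)"
proof -
  show "F 0 (q 0) = q 0" by (simp add: F_def)
  have "q 1 = 0" "q 2 = 1" by (simp_all add: q_def)
  then show "F 0 (q 1) = of_real rho * q 0" "F 0 (q 2) = of_real rho * q 0 + of_real (rho ^ 2)"
    unfolding F_def ratio_def by (simp_all add: rho_sq algebra_simps del: of_real_power)
qed

text \<open>Induction from the right: an appended letter acts innermost, so its shift (0 or rho^2)
  is scaled by rho^n, as in the recursion of \<open>B\<close>.\<close>

lemma Fw_base_word:
  assumes "set ws \<subseteq> {1, 2}"
  shows "\<exists>b\<in>B (length ws). \<forall>x. Fw ws x = of_real (rho ^ length ws) * x + of_real b"
  using assms
proof (induction ws rule: rev_induct)
  case Nil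
  then show ?case by simp
next
  case (snoc i ws)
  then obtain b where b: "b \<in> B (length ws)"
    and eq: "\<And>x. Fw ws x = of_real (rho ^ length ws) * x + of_real b" by auto
  from snoc.prems consider "i = 1" | "i = 2" by auto
  then show ?case
  proof cases
    case 1
    have "Fw (ws @ [i]) x = of_real (rho ^ length (ws @ [i])) * x + of_real b" for x
      by (simp add: Fw_append Fw_single eq 1 F_1[simplified])
    then show ?thesis using B_mono_Suc[OF b] by (intro bexI[of _ b]) auto
  next
    case 2
    have "Fw (ws @ [i]) x = of_real (rho ^ length (ws @ [i])) * x + of_real (b + rho ^ (length ws + 2))" for x
      by (simp add: Fw_append Fw_single eq 2 F_2 algebra_simps power2_eq_square)
    then show ?thesis using B_right_child[OF b]
      by (intro bexI[of _ "b + rho ^ (length ws + 2)"]) auto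
  qed
qed

lemma base_word_exists:
  assumes "b \<in> B n"
  shows "\<exists>ws. set ws \<subseteq> {1, 2} \<and> length ws = n \<and>
    (\<forall>x. Fw ws x = of_real (rho ^ n) * x + of_real b)"
  using assms
proof (induction n arbitrary: b)
  case 0
  then show ?case by (intro exI[of _ "[]"]) simp
next
  case (Suc n)
  from Suc.prems consider "b \<in> B n" | c where "c \<in> B n" "b = c + rho ^ (n + 2)" by auto
  then show ?case
  proof cases
    case 1
    then obtain ws where ws: "set ws \<subseteq> {1, 2}" "length ws = n"
      "\<And>x. Fw ws x = of_real (rho ^ n) * x + of_real b" using Suc.IH by blast
    have "Fw (ws @ [1]) x = of_real (rho ^ Suc n) * x + of_real b" for x
      by (simp add: Fw_append Fw_single ws(3) F_1[simplified])
    then show ?thesis using ws(1,2) by (intro exI[of _ "ws @ [1]"]) auto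
  next
    case (2 c)
    then obtain ws where ws: "set ws \<subseteq> {1, 2}" "length ws = n"
      "\<And>x. Fw ws x = of_real (rho ^ n) * x + of_real c" using Suc.IH by blast
    have "Fw (ws @ [2]) x = of_real (rho ^ Suc n) * x + of_real b" for x
      by (simp add: Fw_append Fw_single ws(3) F_2 2(2) algebra_simps power2_eq_square)
    then show ?thesis using ws(1,2) by (intro exI[of _ "ws @ [2]"]) auto
  qed
qed

text \<open>One representative for each class of words with the same map; this makes the choice
  operator in \<open>W1\<close> meaningful.\<close>

lemma is_W1_W1: "is_W1 W1"
proof -
  define rep where "rep m = (SOME w. w \<in> Wform \<and> Fw w = m)" for m
  have rep: "rep (Fw v) \<in> Wform \<and> Fw (rep (Fw v)) = Fw v" if "v \<in> Wform" for v
    unfolding rep_def by (rule someI_ex) (use that in blast)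
  have "is_W1 (rep ` Fw ` Wform)"
    unfolding is_W1_def using rep by auto
  then show ?thesis unfolding W1_def by (rule someI[of is_W1])
qed

section \<open>Cells indexed by level and position\<close>

definition cell_map :: "nat \<Rightarrow> real \<Rightarrow> complex \<Rightarrow> complex" where
  "cell_map n b x = of_real (rho ^ n) * F 0 x + of_real b"

text \<open>F_0 moves q_1 and q_2 to height 1 - rho^2 = rho, the height of the apexes one level
  further down. This coincidence is what makes the graph graded.\<close>

lemma cell_map_vertices:
  "cell_map n b (q 0) = apex n b" "cell_map n b (q 1) = apex (Suc n) b"
  "cell_map n b (q 2) = apex (Suc n) (b + rho ^ (n + 2))"
  by (simp_all only: cell_map_def apex_def F_0_q0 F_0_q1 F_0_q2)
    (simp_all add: algebra_simps power2_eq_square)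

lemma rho_power_inject: "rho ^ m = rho ^ n \<longleftrightarrow> m = n"
  using power_strict_decreasing[of _ _ rho] rho_pos rho_less_1
  by (metis linorder_neqE_nat order_less_irrefl)

lemma cell_map_inject:
  assumes "cell_map n b = cell_map m c"
  shows "n = m \<and> b = c"
proof -
  have "apex n b = apex m c" using assms by (metis cell_map_vertices(1))
  then have "Im (apex n b) = Im (apex m c)" "Re (apex n b) = Re (apex m c)" by simp_all
  then show ?thesis by (auto simp: apex_def q_def rho_power_inject)
qed

lemma Wform_cell:
  assumes "w \<in> Wform"
  shows "\<exists>n. length w = Suc n \<and> (\<exists>b\<in>B n. Fw w = cell_map n b)"
proof -
  obtain ws where ws: "set ws \<subseteq> {1, 2}" "w = ws @ [0]"
    using assms by (auto simp: Wform_def)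
  then obtain b where "b \<in> B (length ws)"
    "\<And>x. Fw ws x = of_real (rho ^ length ws) * x + of_real b" using Fw_base_word by blast
  then show ?thesis using ws(2)
    by (intro exI[of _ "length ws"]) (auto simp: Fw_append Fw_single cell_map_def fun_eq_iff)
qed

text \<open>With one word per map, and the map determining n by the height of its apex and then b by
  the horizontal coordinate, the arbitrary choice of words disappears: sums over \<open>W1\<close>
  become sums over all cells.\<close>

lemma W1_bij:
  obtains g where "bij_betw g W1 (SIGMA n:UNIV. B n)"
    "\<And>w. w \<in> W1 \<Longrightarrow> length w = Suc (fst (g w)) \<and> Fw w = cell_map (fst (g w)) (snd (g w))"
proof -
  have W1: "W1 \<subseteq> Wform" "\<And>v. v \<in> Wform \<Longrightarrow> \<exists>w\<in>W1. Fw w = Fw v"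
    "\<And>w w'. w \<in> W1 \<Longrightarrow> w' \<in> W1 \<Longrightarrow> Fw w = Fw w' \<Longrightarrow> w = w'"
    using is_W1_W1 by (auto simp: is_W1_def)
  have "\<forall>w\<in>W1. \<exists>p. p \<in> (SIGMA n:UNIV. B n) \<and> length w = Suc (fst p) \<and> Fw w = cell_map (fst p) (snd p)"
    using Wform_cell W1(1) by fastforce
  then obtain g where g: "\<And>w. w \<in> W1 \<Longrightarrow> g w \<in> (SIGMA n:UNIV. B n)"
    "\<And>w. w \<in> W1 \<Longrightarrow> length w = Suc (fst (g w)) \<and> Fw w = cell_map (fst (g w)) (snd (g w))"
    by metis
  have "inj_on g W1"
    using g(2) W1(3) by (metis inj_onI)
  moreover have "(n, b) \<in> g ` W1" if b: "b \<in> B n" for n b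
  proof -
    obtain ws where ws: "set ws \<subseteq> {1, 2}" "length ws = n"
      "\<And>x. Fw ws x = of_real (rho ^ n) * x + of_real b" using base_word_exists[OF b] by blast
    have "ws @ [0] \<in> Wform" using ws(1) by (auto simp: Wform_def)
    then obtain w where w: "w \<in> W1" "Fw w = Fw (ws @ [0])" using W1(2) by blast
    have "Fw (ws @ [0]) = cell_map n b"
      by (simp add: Fw_append Fw_single cell_map_def fun_eq_iff ws(3))
    then have "g w = (n, b)"
      using g(2)[OF w(1)] w(2) cell_map_inject by (metis prod.collapse)
    then show ?thesis using w(1) by force
  qed
  ultimately have "bij_betw g W1 (SIGMA n:UNIV. B n)"
    using g(1) by (fastforce simp: bij_betw_def)
  then show thesis using that g(2) by blast
qed

lemma V1_eq: "V1 = {apex n b | n b. b \<in> B n}"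
proof -
  obtain g where bij: "bij_betw g W1 (SIGMA n:UNIV. B n)"
    and g: "\<And>w. w \<in> W1 \<Longrightarrow> length w = Suc (fst (g w)) \<and> Fw w = cell_map (fst (g w)) (snd (g w))"
    using W1_bij by blast
  have "V1 = (\<Union>w\<in>W1. cell_map (fst (g w)) (snd (g w)) ` V0)"
    using g by (auto simp: V1_def)
  also have "\<dots> = (\<Union>p\<in>g ` W1. cell_map (fst p) (snd p) ` V0)" by simp
  also have "\<dots> = (\<Union>n. \<Union>b\<in>B n. cell_map n b ` V0)"
    unfolding bij_betw_imp_surj_on[OF bij] by force
  also have "\<dots> = (\<Union>n. \<Union>b\<in>B n. {apex n b, apex (Suc n) b, apex (Suc n) (b + rho ^ (n + 2))})"
    by (simp add: V0_def cell_map_vertices cell_map_vertices(2)[simplified])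
  also have "\<dots> = {apex n b | n b. b \<in> B n}"
    using B_mono_Suc B_right_child by blast
  finally show ?thesis .
qed

lemma apex_in_V1: "b \<in> B n \<Longrightarrow> apex n b \<in> V1"
  by (auto simp: V1_eq)

text \<open>The form with coefficients a_01 = a_02 = 1, a_12 = t.\<close>

definition tri_form :: "real \<Rightarrow> real \<Rightarrow> real \<Rightarrow> real \<Rightarrow> real" where
  "tri_form t x y z = (x - y)\<^sup>2 + (x - z)\<^sup>2 + t * (y - z)\<^sup>2"

definition cell :: "real \<Rightarrow> (complex \<Rightarrow> real) \<Rightarrow> nat \<Rightarrow> real \<Rightarrow> real" where
  "cell t f n b = tri_form t (f (apex n b)) (f (apex (Suc n) b)) (f (apex (Suc n) (b + rho ^ (n + 2))))"

definition level_energy :: "real \<Rightarrow> (complex \<Rightarrow> real) \<Rightarrow> nat \<Rightarrow> real" where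
  "level_energy t f n = (\<Sum>b\<in>B n. cell t f n b)"

definition finite_energy :: "real \<Rightarrow> real \<Rightarrow> (complex \<Rightarrow> real) \<Rightarrow> bool" where
  "finite_energy r t f \<longleftrightarrow> summable (\<lambda>n. level_energy t f n / r ^ n)"

definition energy :: "real \<Rightarrow> real \<Rightarrow> (complex \<Rightarrow> real) \<Rightarrow> real" where
  "energy r t f = (\<Sum>n. level_energy t f n / r ^ n)"

definition renorm :: "real \<Rightarrow> real \<Rightarrow> (nat \<Rightarrow> real) \<Rightarrow> real" where
  "renorm r t u = Inf {energy r t f | f. finite_energy r t f \<and> restricts_to f u}"

lemma tri_form_nonneg: "0 \<le> t \<Longrightarrow> 0 \<le> tri_form t x y z"
  by (simp add: tri_form_def)

lemma cell_nonneg: "0 \<le> t \<Longrightarrow> 0 \<le> cell t f n b"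
  by (simp add: cell_def tri_form_nonneg)

lemma level_energy_nonneg: "0 \<le> t \<Longrightarrow> 0 \<le> level_energy t f n"
  by (simp add: level_energy_def sum_nonneg cell_nonneg)

lemma inMS_normal_form:
  assumes "inMS a"
  shows "0 < a 0 1" "0 \<le> a 1 2 / a 0 1"
    "Dform a f f = a 0 1 * tri_form (a 1 2 / a 0 1) (f 0) (f 1) (f 2)"
proof -
  have sym: "\<And>i j. i < 3 \<Longrightarrow> j < 3 \<Longrightarrow> a i j = a j i"
    and diag: "\<And>i. i < 3 \<Longrightarrow> a i i = 0"
    and nn: "\<And>i j. i < 3 \<Longrightarrow> j < 3 \<Longrightarrow> 0 \<le> a i j"
    and irr: "irreducible3 a" and eq: "a 0 1 = a 0 2"
    using assms unfolding inMS_def inM_def by blast+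
  \<comment> \<open>If a_01 = a_02 = 0, then vertex 0 is cut off from the other two, contrary to
    irreducibility.\<close>
  have "a 0 1 \<noteq> 0"
  proof
    assume "a 0 1 = 0"
    then have "{0::nat} \<noteq> {} \<and> {0::nat} \<subset> {0, 1, 2} \<and> (\<forall>i\<in>{0}. \<forall>j\<in>{0, 1, 2} - {0}. a i j = 0)"
      using eq by auto
    then have "\<exists>S. S \<noteq> {} \<and> S \<subset> {0::nat, 1, 2} \<and> (\<forall>i\<in>S. \<forall>j\<in>{0, 1, 2} - S. a i j = 0)"
      by (rule exI[of _ "{0}"])
    then show False using irr[unfolded irreducible3_def] by (rule notE[rotated])
  qed
  then show pos: "0 < a 0 1" using nn[of 0 1] by simp
  show "0 \<le> a 1 2 / a 0 1" using nn[of 1 2] pos by simp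
  have three: "{..<3::nat} = {0, 1, 2}" by auto
  have "a 1 0 = a 0 1" "a 2 0 = a 0 2" "a 2 1 = a 1 2"
    by (rule sym; simp)+
  moreover have "a 0 0 = 0" "a 1 1 = 0" "a 2 2 = 0"
    by (rule diag; simp)+
  ultimately have vals: "a 1 0 = a 0 1" "a 2 0 = a 0 1" "a 2 1 = a 1 2" "a 0 2 = a 0 1"
    "a 0 0 = 0" "a 1 1 = 0" "a 2 2 = 0"
    using eq by simp_all
  have "Dform a f f = a 0 1 * (f 0 - f 1)\<^sup>2 + a 0 1 * (f 0 - f 2)\<^sup>2 + a 1 2 * (f 1 - f 2)\<^sup>2"
    unfolding Dform_def three
    by (simp add: vals del: One_nat_def) (simp add: power2_eq_square algebra_simps)
  also have "\<dots> = a 0 1 * tri_form (a 1 2 / a 0 1) (f 0) (f 1) (f 2)"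
    using pos by (simp add: tri_form_def distrib_left)
  finally show "Dform a f f = a 0 1 * tri_form (a 1 2 / a 0 1) (f 0) (f 1) (f 2)" .
qed

text \<open>A cell of level n has |w| = n + 1, so its weight is r^-n. All terms are nonnegative, so
  the unordered sum over words may be regrouped into an ordinary series over levels.\<close>

lemma Psi_normal_form:
  assumes a: "inMS a" and r: "0 < r"
  defines "t \<equiv> a 1 2 / a 0 1"
  shows "f \<in> DomPsi r a \<longleftrightarrow> finite_energy r t f" "finite_energy r t f \<Longrightarrow> Psi r a f = a 0 1 * energy r t f"
proof -
  obtain g where bij: "bij_betw g W1 (SIGMA n:UNIV. B n)"
    and g: "\<And>w. w \<in> W1 \<Longrightarrow> length w = Suc (fst (g w)) \<and> Fw w = cell_map (fst (g w)) (snd (g w))"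
    using W1_bij by blast
  note nf = inMS_normal_form[OF a, folded t_def]
  define h where "h = (\<lambda>(n, b). a 0 1 * (cell t f n b / r ^ n))"
  have h_nonneg: "0 \<le> h p" for p
    using nf r by (auto simp: h_def cell_nonneg split: prod.split)
  have psi: "psi_term r a f w = h (g w)" if "w \<in> W1" for w
  proof -
    obtain n b where nb: "g w = (n, b)" by fastforce
    have "r powr (1 - real (length w)) = 1 / r ^ n"
      using g[OF that] nb r by (simp add: powr_minus powr_realpow inverse_eq_divide)
    then show ?thesis
      using g[OF that] nb
      by (simp add: psi_term_def nf(3) h_def cell_def cell_map_vertices
          cell_map_vertices(2)[simplified])
  qed
  have level: "(\<Sum>b\<in>B n. h (n, b)) = a 0 1 * (level_energy t f n / r ^ n)" for n
    by (simp add: h_def level_energy_def sum_distrib_left sum_divide_distrib)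
  have "f \<in> DomPsi r a \<longleftrightarrow> (\<lambda>w. h (g w)) summable_on W1"
    using psi by (simp add: DomPsi_def cong: summable_on_cong)
  also have "\<dots> \<longleftrightarrow> h summable_on (SIGMA n:UNIV. B n)"
    by (rule summable_on_reindex_bij_betw[OF bij])
  finally have dom: "f \<in> DomPsi r a \<longleftrightarrow> h summable_on (SIGMA n:UNIV. B n)" .
  have nn: "0 \<le> a 0 1 * (level_energy t f n / r ^ n)" for n
    using nf r by (simp add: level_energy_nonneg)
  have sum_iff: "h summable_on (SIGMA n:UNIV. B n) \<longleftrightarrow> (\<lambda>n. a 0 1 * (level_energy t f n / r ^ n)) summable_on UNIV"
  proof
    assume "h summable_on (SIGMA n:UNIV. B n)"
    then have "(\<lambda>n. infsum (\<lambda>b. h (n, b)) (B n)) summable_on UNIV"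
      using summable_on_Sigma_banach[of "\<lambda>n b. h (n, b)" UNIV B] by simp
    then show "(\<lambda>n. a 0 1 * (level_energy t f n / r ^ n)) summable_on UNIV"
      by (simp only: infsum_finite finite_B level)
  next
    assume "(\<lambda>n. a 0 1 * (level_energy t f n / r ^ n)) summable_on UNIV"
    then show "h summable_on (SIGMA n:UNIV. B n)"
    proof (rule summable_on_SigmaI[rotated])
      show "((\<lambda>b. h (n, b)) has_sum a 0 1 * (level_energy t f n / r ^ n)) (B n)" for n
        unfolding level[symmetric] by (rule has_sum_finite[OF finite_B])
    qed (rule h_nonneg)
  qed
  also have "\<dots> \<longleftrightarrow> finite_energy r t f"
    unfolding summable_on_UNIV_nonneg_real_iff[OF nn] finite_energy_def
    using nf(1) by (subst summable_cmult_iff) auto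
  finally show iff: "f \<in> DomPsi r a \<longleftrightarrow> finite_energy r t f" using dom by simp
  assume finf: "finite_energy r t f"
  then have True: "h summable_on (SIGMA n:UNIV. B n)" using iff dom by simp
  have "Psi r a f = infsum (\<lambda>w. h (g w)) W1"
    using psi by (simp add: Psi_def cong: infsum_cong)
  also have "\<dots> = infsum h (SIGMA n:UNIV. B n)"
    by (rule infsum_reindex_bij_betw[OF bij])
  also have "\<dots> = a 0 1 * energy r t f"
  proof -
    have "infsum h (SIGMA n:UNIV. B n) = infsum (\<lambda>n. infsum (\<lambda>b. h (n, b)) (B n)) UNIV"
      using True by (rule infsum_Sigma_banach[symmetric])
    also have "\<dots> = infsum (\<lambda>n. a 0 1 * (level_energy t f n / r ^ n)) UNIV"
      by (simp only: infsum_finite finite_B level)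
    also have "\<dots> = (\<Sum>n. a 0 1 * (level_energy t f n / r ^ n))"
      using True sum_iff by (intro sums_unique has_sum_imp_sums has_sum_infsum) simp
    also have "\<dots> = a 0 1 * energy r t f"
      unfolding energy_def using finf by (intro suminf_mult) (simp add: finite_energy_def)
    finally show ?thesis .
  qed
  finally show "Psi r a f = a 0 1 * energy r t f" .
qed

section \<open>Boundary values\<close>

text \<open>Together with \<open>hgt\<close> an oblique coordinate system adapted to the apexes: z =
  pos z + hgt z * q_0. Thus hgt, 1 - hgt - pos and pos are the barycentric coordinates with respect
  to q_0, q_1, q_2.\<close>

definition pos :: "complex \<Rightarrow> real" where
  "pos z = Re z - Im z / sqrt 3"

definition hgt :: "complex \<Rightarrow> real" where
  "hgt z = 2 * Im z / sqrt 3"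

lemma hgt_apex [simp]: "hgt (apex n b) = rho ^ n"
  by (simp add: hgt_def apex_def q_def)

lemma pos_apex [simp]: "pos (apex n b) = b"
  by (simp add: pos_def apex_def q_def)

lemma tendsto_pos [tendsto_intros]: "(f \<longlongrightarrow> z) G \<Longrightarrow> ((\<lambda>x. pos (f x)) \<longlongrightarrow> pos z) G"
  and tendsto_hgt [tendsto_intros]: "(f \<longlongrightarrow> z) G \<Longrightarrow> ((\<lambda>x. hgt (f x)) \<longlongrightarrow> hgt z) G"
  unfolding pos_def hgt_def by (auto intro!: tendsto_intros)

lemma pos_hgt_corners [simp]: "pos 0 = 0" "pos 1 = 1" "hgt 0 = 0" "hgt 1 = 0"
  by (simp_all add: pos_def hgt_def)

lemma V1_cases:
  assumes "z \<in> V1"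
  obtains n b where "z = apex n b" "b \<in> B n"
  using assms by (auto simp: V1_eq)

lemma q0_apex: "q 0 = apex 0 0"
  by (simp add: apex_def)

lemma apex_neq_corner: "apex n b \<noteq> 0" "apex n b \<noteq> 1"
  using hgt_apex[of n b] rho_pos by (metis pos_hgt_corners(3,4) less_irrefl zero_less_power)+

lemma q0_isolated: "at (q 0) within V1 = bot"
proof -
  let ?e = "1 - rho"
  have "\<not> q 0 islimpt V1"
  proof
    assume "q 0 islimpt V1"
    moreover have "0 < ?e" using rho_less_1 by simp
    ultimately obtain z where z: "z \<in> V1" "z \<noteq> q 0" "dist z (q 0) < ?e / 2"
      unfolding islimpt_approachable by (meson half_gt_zero)
    then obtain n b where nb: "z = apex n b" "b \<in> B n" by (metis V1_cases)
    have "n \<noteq> 0" using z nb q0_apex by (cases n) auto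
    then have "rho ^ n \<le> rho"
      using rho_pos rho_less_1 power_decreasing[of 1 n rho] by simp
    then have "?e \<le> hgt (q 0) - hgt z" by (simp add: nb q0_apex)
    also have "\<dots> = 2 / sqrt 3 * (Im (q 0 - z))" by (simp add: hgt_def field_simps)
    also have "\<dots> \<le> 2 / sqrt 3 * dist z (q 0)"
      using abs_Im_le_cmod[of "q 0 - z"] by (intro mult_left_mono) (auto simp: dist_norm norm_minus_commute)
    also have "\<dots> \<le> 2 * dist z (q 0)"
      by (intro mult_right_mono) (auto simp: field_simps)
    finally show False using z(3) by simp
  qed
  then show ?thesis by (simp add: trivial_limit_within)
qed

text \<open>q_0 belongs to V_1 and is isolated, all other points having height at most rho, so the
  limit clause is vacuous there. q_1 and q_2 have height 0 and lie outside V_1, so only their limit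
  clauses remain.\<close>

lemma restricts_to_iff:
  "restricts_to f u \<longleftrightarrow> f (q 0) = u 0 \<and> (f \<longlongrightarrow> u 1) (at 0 within V1) \<and> (f \<longlongrightarrow> u 2) (at 1 within V1)"
proof -
  have q12: "q 1 = 0" "q 2 = 1" by (simp_all add: q_def)
  have "q 0 \<in> V1" using apex_in_V1[of 0 0] by (simp add: q0_apex)
  moreover have "q 1 \<notin> V1" "q 2 \<notin> V1"
    using apex_neq_corner unfolding q12 by (metis V1_cases)+
  moreover have "(\<forall>i<3::nat. R i) \<longleftrightarrow> R 0 \<and> R 1 \<and> R 2" for R
    by (auto simp: less_Suc_eq numeral_3_eq_3 numeral_2_eq_2)
  ultimately show ?thesis
    by (simp add: restricts_to_def q0_isolated q12 q12(1)[simplified])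
qed

lemma rho_power_tendsto: "(\<lambda>n. rho ^ n) \<longlonglongrightarrow> 0"
  using rho_pos rho_less_1 by (intro LIMSEQ_realpow_zero) auto

lemma restricts_to_edges:
  assumes "restricts_to f u"
  shows "(\<lambda>n. f (apex n 0)) \<longlonglongrightarrow> u 1" "(\<lambda>n. f (apex n (1 - rho ^ n))) \<longlonglongrightarrow> u 2"
proof -
  have "(\<lambda>n. apex n 0) \<longlonglongrightarrow> of_real 0 * q 0 + of_real 0"
    unfolding apex_def by (intro tendsto_intros tendsto_of_real rho_power_tendsto)
  then have "filterlim (\<lambda>n. apex n 0) (at 0 within V1) sequentially"
    by (auto simp: filterlim_at apex_in_V1 apex_neq_corner)
  then show "(\<lambda>n. f (apex n 0)) \<longlonglongrightarrow> u 1"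
    using assms filterlim_compose unfolding restricts_to_iff by blast
  have "(\<lambda>n. apex n (1 - rho ^ n)) \<longlonglongrightarrow> of_real 0 * q 0 + of_real (1 - 0)"
    unfolding apex_def by (intro tendsto_intros tendsto_of_real rho_power_tendsto)
  then have "filterlim (\<lambda>n. apex n (1 - rho ^ n)) (at 1 within V1) sequentially"
    by (auto simp: filterlim_at apex_in_V1 apex_neq_corner top_in_B)
  then show "(\<lambda>n. f (apex n (1 - rho ^ n))) \<longlonglongrightarrow> u 2"
    using assms filterlim_compose unfolding restricts_to_iff by blast
qed

text \<open>The series law for resistances r^n. It is the Cauchy-Schwarz inequality with weights
  sqrt (r^n), applied to finite telescoping sums because L is only reached in the limit.\<close>

lemma chain_bound:
  fixes x e :: "nat \<Rightarrow> real"
  assumes r: "0 < r" "r < 1" and lim: "x \<longlonglongrightarrow> L" and sum: "summable e"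
    and e: "\<And>n. (x n - x (Suc n))\<^sup>2 / r ^ n \<le> e n"
  shows "(x 0 - L)\<^sup>2 * (1 - r) \<le> suminf e"
proof -
  have e0: "0 \<le> e n" for n using e[of n] r by (smt (verit) divide_nonneg_pos zero_le_power2 zero_less_power)
  have part: "(x 0 - x M)\<^sup>2 * (1 - r) \<le> suminf e" for M
  proof -
    have "x 0 - x M = (\<Sum>n<M. x n - x (Suc n))" by (simp add: sum_lessThan_telescope')
    also have "\<dots> = (\<Sum>n<M. sqrt (r ^ n) * ((x n - x (Suc n)) / sqrt (r ^ n)))"
      using r by (intro sum.cong) auto
    finally have "(x 0 - x M)\<^sup>2
        \<le> (\<Sum>n<M. (sqrt (r ^ n))\<^sup>2) * (\<Sum>n<M. ((x n - x (Suc n)) / sqrt (r ^ n))\<^sup>2)"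
      by (simp only: Cauchy_Schwarz_ineq_sum)
    also have "\<dots> = (\<Sum>n<M. r ^ n) * (\<Sum>n<M. (x n - x (Suc n))\<^sup>2 / r ^ n)"
      using r by (simp add: power_divide)
    also have "\<dots> \<le> (\<Sum>n<M. r ^ n) * (\<Sum>n<M. e n)"
      using e r by (intro mult_left_mono sum_mono sum_nonneg) auto
    also have "\<dots> \<le> (\<Sum>n<M. r ^ n) * suminf e"
      using sum e0 r by (intro mult_left_mono sum_le_suminf sum_nonneg) auto
    finally have "(x 0 - x M)\<^sup>2 * (1 - r) \<le> (1 - r) * (\<Sum>n<M. r ^ n) * suminf e"
      using r by (simp add: mult.commute mult.left_commute)
    also have "(1 - r) * (\<Sum>n<M. r ^ n) = 1 - r ^ M"
      by (simp add: one_diff_power_eq)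
    also have "(1 - r ^ M) * suminf e \<le> 1 * suminf e"
      using suminf_nonneg[OF sum e0] r by (intro mult_right_mono) auto
    finally show ?thesis by simp
  qed
  have "(\<lambda>M. (x 0 - x M)\<^sup>2 * (1 - r)) \<longlonglongrightarrow> (x 0 - L)\<^sup>2 * (1 - r)"
    by (intro tendsto_intros lim)
  then show ?thesis by (rule LIMSEQ_le_const2) (use part in auto)
qed

text \<open>Starting at level k multiplies all resistances by r^k; this decay later makes the values
  on a deep row close to the corner values.\<close>

lemma chain_bound_tail:
  fixes x e :: "nat \<Rightarrow> real"
  assumes r: "0 < r" "r < 1" and lim: "x \<longlonglongrightarrow> L" and sum: "summable e"
    and e: "\<And>n. (x n - x (Suc n))\<^sup>2 / r ^ n \<le> e n"
  shows "(x k - L)\<^sup>2 * (1 - r) \<le> r ^ k * suminf e"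
proof -
  have e0: "0 \<le> e n" for n using e[of n] r by (smt (verit) divide_nonneg_pos zero_le_power2 zero_less_power)
  have "(x (0 + k) - L)\<^sup>2 * (1 - r) \<le> (\<Sum>n. r ^ k * e (n + k))"
  proof (rule chain_bound[OF r])
    show "(\<lambda>n. x (n + k)) \<longlonglongrightarrow> L" by (rule LIMSEQ_ignore_initial_segment[OF lim])
    show "summable (\<lambda>n. r ^ k * e (n + k))"
      using sum by (intro summable_mult) (simp add: summable_iff_shift)
    show "(x (n + k) - x (Suc n + k))\<^sup>2 / r ^ n \<le> r ^ k * e (n + k)" for n
      using mult_left_mono[OF e[of "n + k"], of "r ^ k"] r by (simp add: power_add)
  qed
  also have "\<dots> = r ^ k * (\<Sum>n. e (n + k))"
    using sum by (intro suminf_mult) (simp add: summable_iff_shift)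
  also have "(\<Sum>n. e (n + k)) \<le> suminf e"
    using suminf_split_initial_segment[OF sum, of k] e0 by (simp add: sum_nonneg)
  finally show ?thesis using r by simp
qed

section \<open>Affine competitors and first properties of the trace\<close>

definition aff :: "(nat \<Rightarrow> real) \<Rightarrow> complex \<Rightarrow> real" where
  "aff u z = u 0 * hgt z + u 1 * (1 - hgt z - pos z) + u 2 * pos z"

lemma restricts_aff: "restricts_to (aff u) u"
  unfolding restricts_to_iff
proof (intro conjI)
  show "aff u (q 0) = u 0" by (simp add: aff_def q0_apex)
  have "(aff u \<longlongrightarrow> aff u z) (at z within V1)" for z
    unfolding aff_def by (intro tendsto_intros)
  from this[of 0] this[of 1] show "(aff u \<longlongrightarrow> u 1) (at 0 within V1)" "(aff u \<longlongrightarrow> u 2) (at 1 within V1)"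
    by (simp_all add: aff_def)
qed

text \<open>The map of the cell is a similarity of ratio rho^(n+2), and an affine function scales
  accordingly on it.\<close>

lemma cell_aff: "cell t (aff u) n b = (rho ^ (n + 2))\<^sup>2 * tri_form t (u 0) (u 1) (u 2)"
proof -
  let ?h = "rho ^ (n + 2)"
  have "rho ^ n = rho ^ Suc n + ?h" using rho_power_split[of n] by simp
  then have "aff u (apex n b) - aff u (apex (Suc n) b) = ?h * (u 0 - u 1)"
    "aff u (apex n b) - aff u (apex (Suc n) (b + ?h)) = ?h * (u 0 - u 2)"
    "aff u (apex (Suc n) b) - aff u (apex (Suc n) (b + ?h)) = ?h * (u 1 - u 2)"
    by (simp_all only: aff_def hgt_apex pos_apex) (simp_all only: algebra_simps)
  then show ?thesis
    by (simp only: cell_def tri_form_def power_mult_distrib) (simp only: algebra_simps)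
qed

lemma level_energy_aff_le:
  assumes "0 \<le> t"
  shows "level_energy t (aff u) n \<le> rho ^ n * tri_form t (u 0) (u 1) (u 2)"
proof -
  have "level_energy t (aff u) n = (real (card (B n)) * rho ^ (n + 2)) * (rho ^ (n + 2) * tri_form t (u 0) (u 1) (u 2))"
    by (simp add: level_energy_def cell_aff power2_eq_square)
  also have "\<dots> \<le> 1 * (rho ^ (n + 2) * tri_form t (u 0) (u 1) (u 2))"
    using rho_pos assms by (intro mult_right_mono card_B_le mult_nonneg_nonneg tri_form_nonneg) auto
  also have "rho ^ (n + 2) \<le> rho ^ n"
    using rho_pos rho_less_1 by (intro power_decreasing) auto
  finally show ?thesis using assms by (simp add: mult_right_mono tri_form_nonneg)
qed

lemma aff_energy:
  assumes "0 \<le> t" "rho < r"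
  shows "finite_energy r t (aff u)" "energy r t (aff u) \<le> tri_form t (u 0) (u 1) (u 2) / (1 - rho / r)"
proof -
  let ?d = "tri_form t (u 0) (u 1) (u 2)"
  have r: "0 < r" "rho / r < 1" "0 < rho / r" using assms rho_pos by auto
  have le: "level_energy t (aff u) n / r ^ n \<le> ?d * (rho / r) ^ n" for n
    using divide_right_mono[OF level_energy_aff_le[OF assms(1), of u n], of "r ^ n"] r
    by (simp add: power_divide mult.commute)
  have sum: "(\<lambda>n. ?d * (rho / r) ^ n) sums (?d * (1 / (1 - rho / r)))"
    using r(2,3) by (intro sums_mult geometric_sums) (simp only: real_norm_def abs_of_pos)
  show 1: "finite_energy r t (aff u)"
    unfolding finite_energy_def
  proof (rule summable_comparison_test'[OF sums_summable[OF sum]])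
    fix n :: nat
    show "norm (level_energy t (aff u) n / r ^ n) \<le> ?d * (rho / r) ^ n"
      using le[of n] r level_energy_nonneg[OF assms(1)] by simp
  qed
  show "energy r t (aff u) \<le> ?d / (1 - rho / r)"
    unfolding energy_def using suminf_le[OF le _ sums_summable[OF sum]] 1 sums_unique[OF sum]
    by (simp add: finite_energy_def)
qed

lemma energy_nonneg: "0 \<le> t \<Longrightarrow> 0 < r \<Longrightarrow> finite_energy r t f \<Longrightarrow> 0 \<le> energy r t f"
  unfolding energy_def finite_energy_def by (intro suminf_nonneg) (auto simp: level_energy_nonneg)

lemma renorm_le:
  assumes "0 \<le> t" "0 < r" "finite_energy r t f" "restricts_to f u"
  shows "renorm r t u \<le> energy r t f"
  unfolding renorm_def
proof (rule cInf_lower)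
  show "energy r t f \<in> {energy r t f | f. finite_energy r t f \<and> restricts_to f u}" using assms by blast
  show "bdd_below {energy r t f | f. finite_energy r t f \<and> restricts_to f u}"
    using assms(1,2) energy_nonneg by (intro bdd_belowI[of _ 0]) blast
qed

lemma renorm_set_nonempty:
  assumes "0 \<le> t" "rho < r"
  shows "{energy r t f | f. finite_energy r t f \<and> restricts_to f u} \<noteq> {}"
  using aff_energy(1)[OF assms] restricts_aff by blast

lemma renorm_ge:
  assumes "0 \<le> t" "rho < r" "\<And>f. finite_energy r t f \<Longrightarrow> restricts_to f u \<Longrightarrow> c \<le> energy r t f"
  shows "c \<le> renorm r t u"
  unfolding renorm_def using renorm_set_nonempty[OF assms(1,2)] assms(3) by (intro cInf_greatest) auto

lemma renorm_approx:
  assumes "0 \<le> t" "rho < r" "0 < e"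
  obtains f where "finite_energy r t f" "restricts_to f u" "energy r t f < renorm r t u + e"
proof -
  have "Inf {energy r t f | f. finite_energy r t f \<and> restricts_to f u} < renorm r t u + e"
    using assms(3) by (simp add: renorm_def)
  from cInf_lessD[OF renorm_set_nonempty[OF assms(1,2)] this] that show thesis by blast
qed

lemma renorm_nonneg: "0 \<le> t \<Longrightarrow> rho < r \<Longrightarrow> 0 \<le> renorm r t u"
  using rho_pos by (intro renorm_ge energy_nonneg) auto

lemma renorm_ge_scaled:
  assumes "0 \<le> t" "rho < r" "0 \<le> c"
    and bound: "\<And>f. finite_energy r t f \<Longrightarrow> restricts_to f u \<Longrightarrow> k \<le> c * energy r t f + d"
  shows "k \<le> c * renorm r t u + d"
proof (rule field_le_epsilon)
  fix e :: real assume e: "0 < e"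
  \<comment> \<open>Dividing by c + 1 rather than by c admits c = 0.\<close>
  obtain f where f: "finite_energy r t f" "restricts_to f u" "energy r t f < renorm r t u + e / (c + 1)"
    using renorm_approx[OF assms(1,2), of "e / (c + 1)"] e assms(3) by auto
  have "k \<le> c * energy r t f + d" by (rule bound[OF f(1,2)])
  moreover have "c * energy r t f \<le> c * (renorm r t u + e / (c + 1))"
    using f(3) assms(3) by (intro mult_left_mono) auto
  moreover have "c * (e / (c + 1)) \<le> e" using e assms(3) by (simp add: field_simps)
  ultimately show "k \<le> c * renorm r t u + d + e" by (simp add: distrib_left)
qed

lemma renorm_transfer:
  assumes "0 \<le> t" "rho < r" "0 \<le> t'" "0 < r'" "0 \<le> c"
    and step: "\<And>f. finite_energy r t f \<Longrightarrow> restricts_to f u \<Longrightarrow>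
      \<exists>h. finite_energy r' t' h \<and> restricts_to h u' \<and> energy r' t' h \<le> c * energy r t f + d"
  shows "renorm r' t' u' \<le> c * renorm r t u + d"
  using assms(1,2,5)
proof (rule renorm_ge_scaled)
  fix f assume "finite_energy r t f" "restricts_to f u"
  then show "renorm r' t' u' \<le> c * energy r t f + d"
    using step renorm_le[OF assms(3,4)] by fastforce
qed

lemma Rr_normal_form:
  assumes a: "inMS a" and r: "rho < r"
  shows "Rr r a u = a 0 1 * renorm r (a 1 2 / a 0 1) u"
proof -
  let ?t = "a 1 2 / a 0 1"
  note nf = inMS_normal_form[OF a]
  have r0: "0 < r" using r rho_pos by simp
  define X where "X = {energy r ?t f | f. finite_energy r ?t f \<and> restricts_to f u}"
  have X: "X \<noteq> {}" "\<And>x. x \<in> X \<Longrightarrow> renorm r ?t u \<le> x"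
    using renorm_set_nonempty[OF nf(2) r] renorm_le[OF nf(2) r0] by (auto simp: X_def)
  have "{Psi r a f | f. f \<in> DomPsi r a \<and> restricts_to f u} = (\<lambda>x. a 0 1 * x) ` X"
    using Psi_normal_form[OF a r0] unfolding X_def by (auto simp: image_iff) metis
  then have "Rr r a u = Inf ((\<lambda>x. a 0 1 * x) ` X)"
    by (simp add: Rr_def)
  also have "\<dots> = a 0 1 * renorm r ?t u"
  proof (rule cInf_eq_non_empty)
    show "(\<lambda>x. a 0 1 * x) ` X \<noteq> {}" using X(1) by blast
    show "a 0 1 * renorm r ?t u \<le> x" if x: "x \<in> (\<lambda>x. a 0 1 * x) ` X" for x
    proof -
      obtain y where "y \<in> X" "x = a 0 1 * y" using x by blast
      then show ?thesis using X(2) nf(1) by (simp only: mult_le_cancel_left_pos)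
    qed
    show "y \<le> a 0 1 * renorm r ?t u" if y: "\<And>x. x \<in> (\<lambda>x. a 0 1 * x) ` X \<Longrightarrow> y \<le> x" for y
    proof -
      have "y / a 0 1 \<le> renorm r ?t u"
      proof (rule renorm_ge[OF nf(2) r])
        fix f assume "finite_energy r ?t f" "restricts_to f u"
        then have "energy r ?t f \<in> X" unfolding X_def by blast
        then show "y / a 0 1 \<le> energy r ?t f"
          using y[OF imageI] nf(1) by (simp only: pos_divide_le_eq mult.commute[of _ "a 0 1"])
      qed
      then show ?thesis using nf(1) by (simp add: field_simps)
    qed
  qed
  finally show ?thesis .
qed

section \<open>Monotonicity and symmetry of the renormalized form\<close>

lemma energy_D_le:
  assumes t: "0 \<le> t" "0 \<le> t'" and r: "0 < r" and M: "\<And>x y z. tri_form t' x y z \<le> M * tri_form t x y z" and f: "finite_energy r t f"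
  shows "finite_energy r t' f" "energy r t' f \<le> M * energy r t f"
proof -
  have le: "level_energy t' f n / r ^ n \<le> M * (level_energy t f n / r ^ n)" for n
    using M r by (simp add: level_energy_def sum_distrib_left sum_mono cell_def divide_right_mono)
  have sum: "summable (\<lambda>n. M * (level_energy t f n / r ^ n))"
    using f by (intro summable_mult) (simp add: finite_energy_def)
  show 1: "finite_energy r t' f"
    unfolding finite_energy_def using le level_energy_nonneg[OF t(2)] r
    by (intro summable_comparison_test'[OF sum]) simp
  have "energy r t' f \<le> (\<Sum>n. M * (level_energy t f n / r ^ n))"
    unfolding energy_def using le 1 sum by (intro suminf_le) (auto simp: finite_energy_def)
  also have "\<dots> = M * energy r t f"
    unfolding energy_def using f by (intro suminf_mult) (simp add: finite_energy_def)
  finally show "energy r t' f \<le> M * energy r t f" .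
qed

lemma renorm_D_le:
  assumes "0 \<le> t" "0 \<le> t'" "rho < r" "0 \<le> M" "\<And>x y z. tri_form t' x y z \<le> M * tri_form t x y z"
  shows "renorm r t' u \<le> M * renorm r t u"
proof -
  have r: "0 < r" using assms rho_pos by simp
  have "renorm r t' u \<le> M * renorm r t u + 0"
    by (rule renorm_transfer[OF assms(1,3,2) r assms(4)])
      (use energy_D_le[OF assms(1,2) r assms(5)] in auto)
  then show ?thesis by simp
qed

lemma energy_mono_r:
  assumes t: "0 \<le> t" and r: "0 < r" "r \<le> r'" and f: "finite_energy r t f"
  shows "finite_energy r' t f" "energy r' t f \<le> energy r t f"
proof -
  have le: "level_energy t f n / r' ^ n \<le> level_energy t f n / r ^ n" for n
    using r level_energy_nonneg[OF t] by (intro divide_left_mono power_mono) auto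
  show 1: "finite_energy r' t f"
    unfolding finite_energy_def using le level_energy_nonneg[OF t] r f[unfolded finite_energy_def]
    by (intro summable_comparison_test'[OF f[unfolded finite_energy_def]]) simp
  show "energy r' t f \<le> energy r t f"
    unfolding energy_def using le 1 f by (intro suminf_le) (auto simp: finite_energy_def)
qed

lemma renorm_mono_r:
  assumes "0 \<le> t" "rho < r" "r \<le> r'"
  shows "renorm r' t u \<le> renorm r t u"
proof -
  have r: "0 < r" "0 < r'" using assms rho_pos by simp_all
  have "renorm r' t u \<le> 1 * renorm r t u + 0"
    by (rule renorm_transfer[OF assms(1,2,1) r(2)])
      (use energy_mono_r[OF assms(1) r(1) assms(3)] in auto)
  then show ?thesis by simp
qed

text \<open>The law holds on every cell, and nonnegativity of both left-hand terms yields their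
  finiteness. Energy sees only differences, so a constant c may be added; the case b = 0 is affine
  rescaling.\<close>

lemma energy_parallelogram:
  assumes t: "0 \<le> t" and r: "0 < r" and f: "finite_energy r t f" and g: "finite_energy r t g"
  shows "finite_energy r t (\<lambda>z. a * f z + b * g z + c)"
    "energy r t (\<lambda>z. a * f z + b * g z + c) + energy r t (\<lambda>z. a * f z - b * g z + c)
      = 2 * a\<^sup>2 * energy r t f + 2 * b\<^sup>2 * energy r t g"
proof -
  let ?s = "\<lambda>n. 2 * a\<^sup>2 * (level_energy t f n / r ^ n) + 2 * b\<^sup>2 * (level_energy t g n / r ^ n)"
  have level_energy: "level_energy t (\<lambda>z. a * f z + b * g z + c) n + level_energy t (\<lambda>z. a * f z - b * g z + c) n
      = 2 * a\<^sup>2 * level_energy t f n + 2 * b\<^sup>2 * level_energy t g n" for n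
  proof -
    have "cell t (\<lambda>z. a * f z + b * g z + c) n x + cell t (\<lambda>z. a * f z - b * g z + c) n x
        = 2 * a\<^sup>2 * cell t f n x + 2 * b\<^sup>2 * cell t g n x" for x
      unfolding cell_def tri_form_def by algebra
    then show ?thesis
      by (simp only: level_energy_def sum_distrib_left sum.distrib[symmetric])
  qed
  have s: "?s n = level_energy t (\<lambda>z. a * f z + b * g z + c) n / r ^ n + level_energy t (\<lambda>z. a * f z - b * g z + c) n / r ^ n" for n
    using level_energy[of n] by (simp add: add_divide_distrib[symmetric])
  have sum: "summable ?s"
    using f g unfolding finite_energy_def by (intro summable_add summable_mult)
  have nn: "0 \<le> level_energy t h n / r ^ n" for h n using level_energy_nonneg[OF t] r by simp
  have finite_energy_le: "finite_energy r t h" if "\<And>n. level_energy t h n / r ^ n \<le> ?s n" for h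
    unfolding finite_energy_def using that nn[of h] by (intro summable_comparison_test'[OF sum]) (simp only: real_norm_def abs_of_nonneg)
  have finite_energy: "finite_energy r t (\<lambda>z. a * f z + b * g z + c)" "finite_energy r t (\<lambda>z. a * f z - b * g z + c)"
    by (rule finite_energy_le, unfold s, use nn in simp)+
  show "finite_energy r t (\<lambda>z. a * f z + b * g z + c)" by (rule finite_energy)
  have "energy r t (\<lambda>z. a * f z + b * g z + c) + energy r t (\<lambda>z. a * f z - b * g z + c) = suminf ?s"
    unfolding energy_def s using finite_energy by (intro suminf_add) (auto simp: finite_energy_def)
  also have "\<dots> = 2 * a\<^sup>2 * energy r t f + 2 * b\<^sup>2 * energy r t g"
    using f g unfolding energy_def finite_energy_def by (simp add: suminf_add[symmetric] suminf_mult summable_mult del: times_divide_eq_right)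
  finally show "energy r t (\<lambda>z. a * f z + b * g z + c) + energy r t (\<lambda>z. a * f z - b * g z + c)
      = 2 * a\<^sup>2 * energy r t f + 2 * b\<^sup>2 * energy r t g" .
qed

lemma restricts_linear:
  assumes "restricts_to f u" "restricts_to g v"
  shows "restricts_to (\<lambda>z. a * f z + b * g z + c) (\<lambda>i. a * u i + b * v i + c)"
  using assms unfolding restricts_to_iff by (auto intro!: tendsto_intros)

lemma energy_affine:
  assumes "0 \<le> t" "0 < r" "finite_energy r t f"
  shows "finite_energy r t (\<lambda>z. a * f z + c)" "energy r t (\<lambda>z. a * f z + c) = a\<^sup>2 * energy r t f"
  using energy_parallelogram[OF assms assms(3), of a 0 c] by simp_all

lemma energy_abs:
  assumes t: "0 \<le> t" and r: "0 < r" and f: "finite_energy r t f"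
  shows "finite_energy r t (\<lambda>z. \<bar>f z\<bar>)" "energy r t (\<lambda>z. \<bar>f z\<bar>) \<le> energy r t f"
proof -
  have sq: "(\<bar>x\<bar> - \<bar>y\<bar>)\<^sup>2 \<le> (x - y)\<^sup>2" for x y :: real
    by (rule abs_le_square_iff[THEN iffD1]) (rule abs_triangle_ineq3)
  have le: "level_energy t (\<lambda>z. \<bar>f z\<bar>) n / r ^ n \<le> level_energy t f n / r ^ n" for n
    unfolding level_energy_def cell_def tri_form_def using sq t r
    by (intro divide_right_mono sum_mono add_mono mult_left_mono) auto
  show 1: "finite_energy r t (\<lambda>z. \<bar>f z\<bar>)"
    unfolding finite_energy_def using le level_energy_nonneg[OF t] r
    by (intro summable_comparison_test'[OF f[unfolded finite_energy_def]]) simp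
  show "energy r t (\<lambda>z. \<bar>f z\<bar>) \<le> energy r t f"
    unfolding energy_def using le 1 f by (intro suminf_le) (auto simp: finite_energy_def)
qed

section \<open>Reflection in the vertical axis and the two test boundary values\<close>

definition refl_h :: "complex \<Rightarrow> complex" where
  "refl_h z = 1 - cnj z"

lemma refl_h_apex: "refl_h (apex n b) = apex n (1 - rho ^ n - b)"
  by (simp add: refl_h_def apex_def q_def complex_eq_iff)

text \<open>The reflection permutes the cells of a level and exchanges the two lower vertices of a
  cell, in which \<open>tri_form\<close> is symmetric.\<close>

lemma level_energy_refl_h: "level_energy t (f \<circ> refl_h) n = level_energy t f n"
proof -
  have "cell t (f \<circ> refl_h) n b = cell t f n (1 - rho ^ n - b)" for b
  proof -
    have "1 - rho ^ Suc n - b = 1 - rho ^ n - b + rho ^ (n + 2)"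
      "1 - rho ^ Suc n - (b + rho ^ (n + 2)) = 1 - rho ^ n - b"
      unfolding top_eq by simp_all
    then show ?thesis
      by (simp only: cell_def o_apply refl_h_apex) (simp add: tri_form_def power2_commute add.commute)
  qed
  then have "level_energy t (f \<circ> refl_h) n = (\<Sum>b\<in>B n. cell t f n (1 - rho ^ n - b))"
    by (simp add: level_energy_def)
  also have "\<dots> = level_energy t f n"
    unfolding level_energy_def
    by (rule sum.reindex_bij_witness[where i = "\<lambda>b. 1 - rho ^ n - b" and j = "\<lambda>b. 1 - rho ^ n - b"])
      (auto simp: B_reflect)
  finally show ?thesis .
qed

lemma energy_refl_h: "finite_energy r t (f \<circ> refl_h) = finite_energy r t f" "energy r t (f \<circ> refl_h) = energy r t f"
  by (simp_all add: finite_energy_def energy_def level_energy_refl_h)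

lemma restricts_refl_h:
  assumes "restricts_to f u"
  shows "restricts_to (f \<circ> refl_h) (u \<circ> Transposition.transpose 1 2)"
proof -
  have V1: "refl_h z \<in> V1" if "z \<in> V1" for z
    using that by (elim V1_cases) (simp add: refl_h_apex B_reflect apex_in_V1)
  have q0: "refl_h (q 0) = q 0" by (simp add: q0_apex refl_h_apex)
  have inj: "refl_h z = refl_h w \<longleftrightarrow> z = w" for z w by (simp add: refl_h_def)
  have "((\<lambda>z. refl_h z) \<longlongrightarrow> refl_h w) (at w within V1)" for w
    unfolding refl_h_def by (intro tendsto_intros)
  then have "filterlim refl_h (at (refl_h w) within V1) (at w within V1)" for w
    using V1 inj by (auto simp: filterlim_at eventually_at_filter)
  from this[of 0] this[of 1] show ?thesis
    using assms unfolding restricts_to_iff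
    by (auto simp: q0 o_def refl_h_def[of 0] refl_h_def[of 1] intro: filterlim_compose)
qed

definition u_sym :: "nat \<Rightarrow> real" where
  "u_sym i = (if i = 0 then 1 else 0)"

definition u_alt :: "nat \<Rightarrow> real" where
  "u_alt i = (if i = 1 then 1 else if i = 2 then -1 else 0)"

lemma restricts_cong:
  "restricts_to f u \<Longrightarrow> u 0 = v 0 \<Longrightarrow> u 1 = v 1 \<Longrightarrow> u 2 = v 2 \<Longrightarrow> restricts_to f v"
  by (simp add: restricts_to_iff)

lemma renorm_le_scaled:
  assumes "0 \<le> t" "rho < r" "finite_energy r t f" "restricts_to f v"
    "v 0 = x * u 0 + m" "v 1 = x * u 1 + m" "v 2 = x * u 2 + m"
  shows "x\<^sup>2 * renorm r t u \<le> energy r t f"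
proof (cases "x = 0")
  case True
  then show ?thesis using energy_nonneg assms rho_pos by simp
next
  case False
  have r: "0 < r" using assms rho_pos by simp
  have "restricts_to (\<lambda>z. (1 / x) * f z + 0 * f z + (- m / x)) u"
    by (rule restricts_cong[OF restricts_linear[OF assms(4,4)]]) (use assms(5-7) False in \<open>auto simp: field_simps\<close>)
  then have "restricts_to (\<lambda>z. (1 / x) * f z + (- m / x)) u" by simp
  then have "renorm r t u \<le> (1 / x)\<^sup>2 * energy r t f"
    using renorm_le[OF assms(1) r energy_affine(1)[OF assms(1) r assms(3)]]
      energy_affine(2)[OF assms(1) r assms(3)] by metis
  then show ?thesis using False by (simp add: field_simps power_divide)
qed

text \<open>The reflection removes the cross term. The even and odd halves of a competitor for u
  have energies adding up to its own, which gives one inequality. Conversely x f + y g + m and the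
  reflection of x f - y g + m are both competitors for u, and by the parallelogram law their mean
  energy is that of the two parts.\<close>

lemma renorm_decompose:
  fixes u :: "nat \<Rightarrow> real"
  assumes t: "0 \<le> t" and r: "rho < r"
  defines "x \<equiv> u 0 - (u 1 + u 2) / 2" and "y \<equiv> (u 1 - u 2) / 2"
  shows "renorm r t u = x\<^sup>2 * renorm r t u_sym + y\<^sup>2 * renorm r t u_alt"
proof (rule antisym)
  let ?m = "(u 1 + u 2) / 2" and ?\<sigma> = "Transposition.transpose (1::nat) 2"
  have r0: "0 < r" using r rho_pos by simp
  have swap: "?\<sigma> 0 = 0" "?\<sigma> 1 = 2" "?\<sigma> 2 = 1"
    by (simp_all add: Transposition.transpose_def)
  show "x\<^sup>2 * renorm r t u_sym + y\<^sup>2 * renorm r t u_alt \<le> renorm r t u"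
  proof (rule renorm_ge[OF t r])
    fix f assume f: "finite_energy r t f" "restricts_to f u"
    have g: "finite_energy r t (f \<circ> refl_h)" "restricts_to (f \<circ> refl_h) (u \<circ> ?\<sigma>)"
      using f restricts_refl_h by (simp_all add: energy_refl_h)
    note P = energy_parallelogram[OF t r0 f(1) g(1)]
    have "x\<^sup>2 * renorm r t u_sym \<le> energy r t (\<lambda>z. 1/2 * f z + 1/2 * (f \<circ> refl_h) z + 0)"
      by (rule renorm_le_scaled[OF t r P(1) restricts_linear[OF f(2) g(2)], where m = ?m])
        (simp_all add: swap swap[simplified] x_def u_sym_def field_simps)
    moreover have "y\<^sup>2 * renorm r t u_alt \<le> energy r t (\<lambda>z. 1/2 * f z + (-1/2) * (f \<circ> refl_h) z + 0)"
      by (rule renorm_le_scaled[OF t r P(1) restricts_linear[OF f(2) g(2)], where m = 0])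
        (simp_all add: swap swap[simplified] y_def u_alt_def field_simps)
    moreover have "energy r t (\<lambda>z. 1/2 * f z + 1/2 * (f \<circ> refl_h) z + 0)
        + energy r t (\<lambda>z. 1/2 * f z + (-1/2) * (f \<circ> refl_h) z + 0) = energy r t f"
      using P(2)[of "1/2" "1/2" 0] by (simp add: energy_refl_h power2_eq_square)
    ultimately show "x\<^sup>2 * renorm r t u_sym + y\<^sup>2 * renorm r t u_alt \<le> energy r t f" by linarith
  qed
  have le: "renorm r t u \<le> x\<^sup>2 * energy r t f + y\<^sup>2 * energy r t g"
    if f: "finite_energy r t f" "restricts_to f u_sym" and g: "finite_energy r t g" "restricts_to g u_alt" for f g
  proof -
    note P = energy_parallelogram[OF t r0 f(1) g(1)]
    have h: "restricts_to (\<lambda>z. x * f z + y * g z + ?m) u"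
      by (rule restricts_cong[OF restricts_linear[OF f(2) g(2)]])
        (simp_all add: x_def y_def u_sym_def u_alt_def field_simps)
    have "restricts_to ((\<lambda>z. x * f z + (- y) * g z + ?m) \<circ> refl_h) u"
      by (rule restricts_cong[OF restricts_refl_h[OF restricts_linear[OF f(2) g(2)]]])
        (simp_all add: swap swap[simplified] x_def y_def u_sym_def u_alt_def field_simps)
    then have "renorm r t u \<le> energy r t (\<lambda>z. x * f z + (- y) * g z + ?m)"
      using renorm_le[OF t r0, of "(\<lambda>z. x * f z + (- y) * g z + ?m) \<circ> refl_h" u] P(1)[of x "- y" ?m]
      by (simp add: energy_refl_h)
    moreover have "renorm r t u \<le> energy r t (\<lambda>z. x * f z + y * g z + ?m)"
      by (rule renorm_le[OF t r0 P(1) h])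
    ultimately show ?thesis using P(2)[of x y ?m] by simp
  qed
  \<comment> \<open>The infimum over the pair (f, g) is taken one variable at a time.\<close>
  have le2: "renorm r t u \<le> x\<^sup>2 * renorm r t u_sym + y\<^sup>2 * energy r t g"
    if g: "finite_energy r t g" "restricts_to g u_alt" for g
    by (rule renorm_ge_scaled[OF t r]) (use le g in auto)
  have "renorm r t u \<le> y\<^sup>2 * renorm r t u_alt + x\<^sup>2 * renorm r t u_sym"
    by (rule renorm_ge_scaled[OF t r]) (use le2 in \<open>auto simp: add.commute\<close>)
  then show "renorm r t u \<le> x\<^sup>2 * renorm r t u_sym + y\<^sup>2 * renorm r t u_alt" by simp
qed

lemma renorm_sym_le_alt:
  assumes t: "0 \<le> t" and r: "rho < r"
  shows "renorm r t u_sym \<le> renorm r t u_alt"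
proof -
  have r0: "0 < r" using r rho_pos by simp
  have "renorm r t u_sym \<le> 1 * renorm r t u_alt + 0"
  proof (rule renorm_transfer[OF t r t r0], goal_cases)
    case (2 f)
    have "restricts_to (\<lambda>z. \<bar>f z\<bar>) (\<lambda>i. \<bar>u_alt i\<bar>)"
      using 2(2) unfolding restricts_to_iff by (auto intro!: tendsto_intros)
    from restricts_cong[OF restricts_linear[OF this this], where v = u_sym, of "-1" 0 1]
    have "restricts_to (\<lambda>z. (-1) * \<bar>f z\<bar> + 0 * \<bar>f z\<bar> + 1) u_sym"
      by (simp add: u_sym_def u_alt_def)
    moreover note energy_affine[OF t r0 energy_abs(1)[OF t r0 2(1)], of "-1" 1]
      energy_abs(2)[OF t r0 2(1)]
    ultimately show ?case
      by (intro exI[of _ "\<lambda>z. (-1) * \<bar>f z\<bar> + 1"]) simp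
  qed simp
  then show ?thesis by simp
qed

section \<open>Eigenforms for a fixed scaling factor\<close>

text \<open>In the coordinates x - (y + z)/2 and (y - z)/2 the form is diagonal with coefficients 2
  and 2 (1 + 2 t). The factor is attained on the odd part, just as equality in
  \<open>tri_form_mono\<close> occurs on the even part.\<close>

lemma tri_form_ratio:
  assumes "0 \<le> t" "t \<le> t'"
  shows "tri_form t' x y z \<le> (1 + 2 * t') / (1 + 2 * t) * tri_form t x y z"
proof -
  let ?a = "x - (y + z) / 2" and ?b = "(y - z) / 2" and ?M = "(1 + 2 * t') / (1 + 2 * t)"
  have tri_form: "tri_form s x y z = 2 * ?a\<^sup>2 + 2 * ((1 + 2 * s) * ?b\<^sup>2)" for s
    by (simp add: tri_form_def power2_eq_square field_simps)
  have "1 \<le> ?M" using assms by simp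
  then have "1 * (2 * ?a\<^sup>2) \<le> ?M * (2 * ?a\<^sup>2)" by (rule mult_right_mono) simp
  then have "2 * ?a\<^sup>2 \<le> ?M * (2 * ?a\<^sup>2)" by (simp only: mult_1)
  moreover have "2 * ((1 + 2 * t') * ?b\<^sup>2) = ?M * (2 * ((1 + 2 * t) * ?b\<^sup>2))"
    using assms by simp
  ultimately show ?thesis unfolding tri_form by (simp only: distrib_left)
qed

lemma tri_form_mono:
  assumes "t \<le> t'"
  shows "tri_form t x y z \<le> tri_form t' x y z"
  using assms by (simp add: tri_form_def mult_right_mono)

lemma tri_form_lipschitz:
  assumes "0 \<le> t" "t \<le> t'"
  shows "tri_form t' x y z \<le> (1 + 2 * (t' - t)) * tri_form t x y z"
proof -
  have "(y - z)\<^sup>2 \<le> 2 * (x - y)\<^sup>2 + 2 * (x - z)\<^sup>2"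
    using zero_le_power2[of "(x - y) + (x - z)"] by (simp add: power2_eq_square algebra_simps)
  also have "\<dots> \<le> 2 * tri_form t x y z" using assms by (simp add: tri_form_def)
  finally have "(t' - t) * (y - z)\<^sup>2 \<le> (t' - t) * (2 * tri_form t x y z)"
    using assms by (intro mult_left_mono) auto
  moreover have "tri_form t' x y z = tri_form t x y z + (t' - t) * (y - z)\<^sup>2" by (simp add: tri_form_def algebra_simps)
  ultimately show ?thesis by (simp add: algebra_simps)
qed

lemma renorm_mono_t:
  assumes "0 \<le> t" "t \<le> t'" "rho < r"
  shows "renorm r t u \<le> renorm r t' u"
  using renorm_D_le[of t' t r 1 u] tri_form_mono[OF assms(2)] assms by simp

lemma renorm_ratio:
  assumes "0 \<le> t" "t \<le> t'" "rho < r"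
  shows "renorm r t' u \<le> (1 + 2 * t') / (1 + 2 * t) * renorm r t u"
  using assms by (intro renorm_D_le tri_form_ratio) auto

lemma renorm_continuous_t:
  assumes "rho < r"
  shows "continuous_on {0..T} (\<lambda>t. renorm r t u)"
proof (cases "0 \<le> T")
  case True
  have step: "\<bar>renorm r t' u - renorm r t u\<bar> \<le> 2 * renorm r T u * \<bar>t' - t\<bar>" if "0 \<le> t" "t \<le> t'" "t' \<le> T" for t t'
  proof -
    have "renorm r t' u \<le> (1 + 2 * (t' - t)) * renorm r t u"
      using that assms by (intro renorm_D_le tri_form_lipschitz) auto
    moreover have "renorm r t u \<le> renorm r T u" using that assms by (intro renorm_mono_t) auto
    then have "2 * (t' - t) * renorm r t u \<le> 2 * (t' - t) * renorm r T u"
      using that by (intro mult_left_mono) auto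
    moreover have "renorm r t u \<le> renorm r t' u" using that assms by (intro renorm_mono_t) auto
    ultimately show ?thesis using that by (simp add: algebra_simps)
  qed
  have "(2 * renorm r T u)-lipschitz_on {0..T} (\<lambda>t. renorm r t u)"
  proof (rule lipschitz_onI)
    show "0 \<le> 2 * renorm r T u" using renorm_nonneg[OF True assms] by simp
    fix t t' assume "t \<in> {0..T}" "t' \<in> {0..T}"
    then show "dist (renorm r t u) (renorm r t' u) \<le> 2 * renorm r T u * dist t t'"
      using step[of t t'] step[of t' t] unfolding dist_real_def
      by (cases "t \<le> t'") (auto simp: abs_minus_commute)
  qed
  then show ?thesis by (rule lipschitz_on_continuous_on)
qed simp

text \<open>The limits at q_1 and q_2 see only small heights, so a function may be changed freely
  above a positive height as long as its value at q_0 is right.\<close>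

lemma restricts_local:
  assumes "restricts_to f v" "h (q 0) = u 0" "v 1 = u 1" "v 2 = u 2" "0 < c" "\<And>z. hgt z < c \<Longrightarrow> h z = f z"
  shows "restricts_to h u"
proof -
  have ev: "eventually (\<lambda>z. f z = h z) (at w within V1)" if "hgt w = 0" for w
  proof -
    have "((\<lambda>z. hgt z) \<longlongrightarrow> hgt w) (at w within V1)" by (intro tendsto_intros)
    then have "eventually (\<lambda>z. hgt z < c) (at w within V1)"
      using that assms(5) by (intro order_tendstoD(2)[of _ "hgt w"]) auto
    then show ?thesis by eventually_elim (simp add: assms(6))
  qed
  show ?thesis
    using assms(1-4) Lim_transform_eventually[OF _ ev[of 0]] Lim_transform_eventually[OF _ ev[of 1]]
    unfolding restricts_to_iff by simp
qed

lemma rho_power_less: "rho ^ m < rho ^ n \<longleftrightarrow> n < m"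
  using rho_pos rho_less_1 by (intro power_strict_decreasing_iff) auto

lemma level_energy_split: "level_energy t f n = level_energy 0 f n + t * (\<Sum>b\<in>B n. (f (apex (Suc n) b) - f (apex (Suc n) (b + rho ^ (n + 2))))\<^sup>2)"
  by (simp add: level_energy_def cell_def tri_form_def sum.distrib sum_distrib_left)

text \<open>An affine function cut off on the upper levels shows that the slope in t is small.\<close>

lemma renorm_slope_small:
  assumes r: "rho < r" and c: "0 < c"
  shows "\<exists>\<alpha>\<ge>0. \<forall>t\<ge>0. renorm r t u_alt \<le> \<alpha> + c * t"
proof -
  have r0: "0 < r" using r rho_pos by simp
  let ?x = "rho / r"
  have x: "0 < ?x" "?x < 1" using r r0 rho_pos by auto
  \<comment> \<open>The constant 6 is the value of \<open>tri_form 1\<close> at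
    \<open>u_alt\<close>; k makes the tail 6 * (x^k + x^(k+1) + ...) smaller than c.\<close>
  obtain k where k: "?x ^ k < c * (1 - ?x) / 6"
    using real_arch_pow_inv[of "c * (1 - ?x) / 6" ?x] x c by auto
  define f where "f z = (if hgt z > rho ^ Suc k then 0 else aff u_alt z)" for z
  \<comment> \<open>This is the part of the level energy that t multiplies. The cutoff makes it
    vanish before level k, and from there on it is bounded by the geometric tail.\<close>
  define H where "H n = (\<Sum>b\<in>B n. (f (apex (Suc n) b) - f (apex (Suc n) (b + rho ^ (n + 2))))\<^sup>2)" for n
  have Du: "tri_form 1 (u_alt 0) (u_alt 1) (u_alt 2) = 6" by (simp add: tri_form_def u_alt_def)
  have f_low: "f (apex n b) = aff u_alt (apex n b)" if "Suc k \<le> n" for n b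
    using that by (simp add: f_def rho_power_less del: power_Suc)
  have f_high: "f (apex n b) = 0" if "n < Suc k" for n b
    using that by (simp add: f_def rho_power_less del: power_Suc)
  have H_high: "H n = 0" if "n < k" for n
    using that by (simp add: H_def f_high)
  have aff1: "level_energy 1 (aff u_alt) n \<le> 6 * rho ^ n" for n
    using level_energy_aff_le[of 1 u_alt n] Du by simp
  have H_le: "H n \<le> 6 * rho ^ n" if "k \<le> n" for n
  proof -
    have "H n \<le> level_energy 1 (aff u_alt) n"
      unfolding level_energy_split[of 1] using that level_energy_nonneg[of 0] by (simp add: H_def f_low)
    then show ?thesis using aff1[of n] by linarith
  qed
  have H_nonneg: "0 \<le> H n" for n by (simp add: H_def sum_nonneg)
  let ?g = "\<lambda>n. if n < k then 0 else 6 * ?x ^ n"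
  have Hg: "H n / r ^ n \<le> ?g n" for n
    using H_high[of n] H_le[of n] r0 by (simp add: power_divide divide_right_mono)
  have geo: "(\<lambda>n. 6 * ?x ^ k * ?x ^ n) sums (6 * ?x ^ k * (1 / (1 - ?x)))"
    using x by (intro sums_mult geometric_sums) (simp only: real_norm_def abs_of_pos)
  have "(\<lambda>n. ?g (n + k)) sums (6 * ?x ^ k * (1 / (1 - ?x)))"
    using geo by (simp add: power_add mult.assoc mult.commute[of "?x ^ k"])
  then have g: "?g sums (6 * ?x ^ k * (1 / (1 - ?x)))"
    using sums_iff_shift[of ?g k] by simp
  have gc: "6 * ?x ^ k * (1 / (1 - ?x)) \<le> c"
  proof -
    have "6 * ?x ^ k \<le> c * (1 - ?x)"
      using k by (simp only: pos_less_divide_eq zero_less_numeral mult.commute[of 6] less_imp_le)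
    moreover have "0 < 1 - ?x" using x by simp
    ultimately have "6 * ?x ^ k / (1 - ?x) \<le> c" by (simp only: pos_divide_le_eq)
    then show ?thesis by simp
  qed
  have sumH: "summable (\<lambda>n. H n / r ^ n)"
    using Hg H_nonneg r0 by (intro summable_comparison_test'[OF sums_summable[OF g]]) simp
  have "(\<Sum>n. H n / r ^ n) \<le> suminf ?g"
    by (rule suminf_le[OF Hg sumH sums_summable[OF g]])
  then have H_sum: "(\<Sum>n. H n / r ^ n) \<le> c" using gc sums_unique[OF g] by simp
  have fin0: "finite_energy r 0 f"
    unfolding finite_energy_def
  proof (rule summable_comparison_test'[where N = "Suc k"])
    show "summable (\<lambda>n. level_energy 0 (aff u_alt) n / r ^ n)"
      using aff_energy(1)[of 0 r u_alt] r by (simp add: finite_energy_def)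
    fix n assume "Suc k \<le> n"
    then have "level_energy 0 f n = level_energy 0 (aff u_alt) n"
      by (simp add: level_energy_def cell_def f_low)
    then show "norm (level_energy 0 f n / r ^ n) \<le> level_energy 0 (aff u_alt) n / r ^ n"
      using level_energy_nonneg[of 0 f n] r0 by simp
  qed
  have "restricts_to f u_alt"
  proof (rule restricts_local[OF restricts_aff])
    show "f (q 0) = u_alt 0" using f_high[of 0] by (simp add: q0_apex u_alt_def)
    show "0 < rho ^ Suc k" using rho_pos by simp
    show "f z = aff u_alt z" if "hgt z < rho ^ Suc k" for z
      using that by (simp add: f_def)
  qed simp_all
  note f_restr = this
  have bound: "renorm r t u_alt \<le> energy r 0 f + c * t" if t: "0 \<le> t" for t
  proof -
    have split: "level_energy t f n / r ^ n = level_energy 0 f n / r ^ n + t * (H n / r ^ n)" for n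
      unfolding level_energy_split[of t] H_def by (simp add: add_divide_distrib)
    have "finite_energy r t f"
      unfolding finite_energy_def split using fin0 sumH by (intro summable_add summable_mult) (simp_all add: finite_energy_def)
    moreover have "energy r t f = energy r 0 f + t * (\<Sum>n. H n / r ^ n)"
      unfolding energy_def split using fin0 sumH
      by (subst suminf_add[symmetric]) (simp_all only: finite_energy_def summable_mult suminf_mult)
    moreover have "t * (\<Sum>n. H n / r ^ n) \<le> t * c" using H_sum t by (rule mult_left_mono)
    ultimately show ?thesis using renorm_le[OF t r0 _ f_restr] by (simp add: mult.commute) 
  qed
  show ?thesis
    using bound energy_nonneg[OF order_refl r0 fin0] by (intro exI[of _ "energy r 0 f"]) auto
qed

lemma left_edge_le: "0 \<le> t \<Longrightarrow> (f (apex n b) - f (apex (Suc n) b))\<^sup>2 \<le> cell t f n b"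
  and right_edge_le: "0 \<le> t \<Longrightarrow> (f (apex n b) - f (apex (Suc n) (b + rho ^ (n + 2))))\<^sup>2 \<le> cell t f n b"
  by (simp_all add: cell_def tri_form_def)

lemma level_energy_ge_cell:
  assumes "0 \<le> t" "b \<in> B n"
  shows "cell t f n b \<le> level_energy t f n"
  unfolding level_energy_def using assms cell_nonneg by (intro member_le_sum) auto

lemma left_corner_bound:
  assumes t: "0 \<le> t" and r: "0 < r" "r < 1" and f: "finite_energy r t f" "restricts_to f u"
  shows "(f (apex k 0) - u 1)\<^sup>2 * (1 - r) \<le> r ^ k * energy r t f"
  unfolding energy_def
proof (rule chain_bound_tail[OF r restricts_to_edges(1)[OF f(2)] f(1)[unfolded finite_energy_def]])
  show "(f (apex n 0) - f (apex (Suc n) 0))\<^sup>2 / r ^ n \<le> level_energy t f n / r ^ n" for n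
    using left_edge_le[OF t, of f n 0] level_energy_ge_cell[OF t zero_in_B, of f n] r
    by (intro divide_right_mono) auto
qed

lemma right_edge_top_le:
  assumes "0 \<le> t"
  shows "(f (apex n (1 - rho ^ n)) - f (apex (Suc n) (1 - rho ^ Suc n)))\<^sup>2 \<le> cell t f n (1 - rho ^ n)"
  using right_edge_le[OF assms, of f n "1 - rho ^ n"] unfolding top_eq .

lemma right_corner_bound:
  assumes t: "0 \<le> t" and r: "0 < r" "r < 1" and f: "finite_energy r t f" "restricts_to f u"
  shows "(f (apex k (1 - rho ^ k)) - u 2)\<^sup>2 * (1 - r) \<le> r ^ k * energy r t f"
  unfolding energy_def
proof (rule chain_bound_tail[OF r restricts_to_edges(2)[OF f(2)] f(1)[unfolded finite_energy_def]])
  show "(f (apex n (1 - rho ^ n)) - f (apex (Suc n) (1 - rho ^ Suc n)))\<^sup>2 / r ^ n \<le> level_energy t f n / r ^ n" for n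
    using right_edge_top_le[OF t, of f n] level_energy_ge_cell[OF t top_in_B, of f n] r
    by (intro divide_right_mono) auto
qed

lemma renorm_sym_pos:
  assumes "0 \<le> t" "rho < r" "r < 1"
  shows "0 < renorm r t u_sym"
proof -
  have r0: "0 < r" using assms rho_pos by simp
  have "1 - r \<le> renorm r t u_sym"
  proof (rule renorm_ge[OF assms(1,2)])
    fix f assume f: "finite_energy r t f" "restricts_to f u_sym"
    have "f (apex 0 0) = 1" "u_sym 1 = 0"
      using f(2) by (simp_all add: restricts_to_iff u_sym_def flip: q0_apex)
    then show "1 - r \<le> energy r t f"
      using left_corner_bound[OF assms(1) r0 assms(3) f, of 0] by simp
  qed
  then show ?thesis using assms by simp
qed

lemma eigenform_exists:
  assumes r: "rho < r" "r < 1"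
  shows "\<exists>t\<ge>0. renorm r t u_alt = (1 + 2 * t) * renorm r t u_sym"
proof -
  let ?p = "renorm r 0 u_sym"
  have p: "0 < ?p" using renorm_sym_pos[OF order_refl r] .
  obtain \<alpha> where \<alpha>: "0 \<le> \<alpha>" "\<And>t. 0 \<le> t \<Longrightarrow> renorm r t u_alt \<le> \<alpha> + ?p * t"
    using renorm_slope_small[OF r(1) p] by blast
  \<comment> \<open>The odd trace has slope at most p in t, the right-hand side grows at least with
    slope 2 p. At \<alpha> / p the former is at most 2 \<alpha>, the latter at least p + 2
    \<alpha>.\<close>
  let ?T = "\<alpha> / ?p"
  have T: "0 \<le> ?T" using \<alpha> p by simp
  have "\<exists>t\<ge>0. t \<le> ?T \<and> renorm r t u_alt - (1 + 2 * t) * renorm r t u_sym = 0"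
  proof (rule IVT2')
    have "(1 + 2 * ?T) * ?p \<le> (1 + 2 * ?T) * renorm r ?T u_sym"
      using renorm_mono_t[OF order_refl T r(1)] T by (intro mult_left_mono) auto
    moreover have "(1 + 2 * ?T) * ?p = ?p + 2 * \<alpha>" using p by (simp add: distrib_right)
    moreover have "\<alpha> + ?p * ?T = 2 * \<alpha>" using p by simp
    ultimately show "renorm r ?T u_alt - (1 + 2 * ?T) * renorm r ?T u_sym \<le> 0"
      using \<alpha>(2)[OF T] p by linarith
    show "0 \<le> renorm r 0 u_alt - (1 + 2 * 0) * renorm r 0 u_sym"
      using renorm_sym_le_alt[OF order_refl r(1)] by simp
    show "continuous_on {0..?T} (\<lambda>t. renorm r t u_alt - (1 + 2 * t) * renorm r t u_sym)"
      by (intro continuous_intros renorm_continuous_t r(1))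
  qed (rule T)
  then show ?thesis by auto
qed

text \<open>\<open>tri_form t\<close> takes the values 2 and 2 + 4 t at \<open>u_sym\<close> and
  \<open>u_alt\<close>. By the even-odd splitting these two test values already give proportionality
  on all boundary values.\<close>

definition eigenform :: "real \<Rightarrow> real \<Rightarrow> real \<Rightarrow> bool" where
  "eigenform r t l \<longleftrightarrow> 0 \<le> t \<and> renorm r t u_sym = 2 * l \<and> renorm r t u_alt = (2 + 4 * t) * l"

text \<open>Compare the forms with parameters s and t by the best constant: the comparison is an equality at
  one of the two boundary values.\<close>

lemma eigenform_min_max:
  assumes e: "eigenform r s l" and r: "rho < r" and t: "0 \<le> t"
  shows "min (renorm r t u_sym / 2) (renorm r t u_alt / (2 + 4 * t)) \<le> l"
    and "l \<le> max (renorm r t u_sym / 2) (renorm r t u_alt / (2 + 4 * t))"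
proof -
  have s: "0 \<le> s" and P: "renorm r s u_sym = 2 * l" and Q: "renorm r s u_alt = (2 + 4 * s) * l"
    using e by (auto simp: eigenform_def)
  show "min (renorm r t u_sym / 2) (renorm r t u_alt / (2 + 4 * t)) \<le> l"
  proof (cases "t \<le> s")
    case True
    then have "renorm r t u_sym \<le> 2 * l" using renorm_mono_t[OF t True r, of u_sym] P by simp
    then show ?thesis by simp
  next
    case False
    then have "renorm r t u_alt \<le> (1 + 2 * t) / (1 + 2 * s) * renorm r s u_alt"
      using renorm_ratio[OF s _ r, of t u_alt] by simp
    also have "\<dots> = (2 + 4 * t) * l" using s by (simp add: Q field_simps)
    finally show ?thesis using t by (simp add: min_le_iff_disj field_simps)
  qed
  show "l \<le> max (renorm r t u_sym / 2) (renorm r t u_alt / (2 + 4 * t))"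
  proof (cases "s \<le> t")
    case True
    then show ?thesis using renorm_mono_t[OF s True r, of u_sym] P by (simp add: le_max_iff_disj)
  next
    case False
    then have "(2 + 4 * s) * l \<le> (1 + 2 * s) / (1 + 2 * t) * renorm r t u_alt"
      using renorm_ratio[OF t _ r, of s u_alt] Q by simp
    then have "(1 + 2 * s) * (2 * l) \<le> (1 + 2 * s) * (renorm r t u_alt / (1 + 2 * t))"
      by (simp add: algebra_simps)
    then have "2 * l \<le> renorm r t u_alt / (1 + 2 * t)"
      using s by (subst (asm) mult_le_cancel_left_pos) auto
    then have "l \<le> renorm r t u_alt / (2 + 4 * t)" using t by (simp add: field_simps)
    then show ?thesis by simp
  qed
qed

text \<open>The form with parameter t is used as a test form for r': both of its quotients can only
  decrease from l, and the larger one bounds l'. The case r = r' shows that r determines the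
  eigenvalue.\<close>

lemma eigenform_mono_r:
  assumes "eigenform r t l" "eigenform r' t' l'" "rho < r" "r \<le> r'"
  shows "l' \<le> l"
proof -
  have t: "0 \<le> t" and P: "renorm r t u_sym = 2 * l" and Q: "renorm r t u_alt = (2 + 4 * t) * l"
    using assms(1) by (auto simp: eigenform_def)
  have "l' \<le> max (renorm r' t u_sym / 2) (renorm r' t u_alt / (2 + 4 * t))"
    using eigenform_min_max(2)[OF assms(2) _ t] assms(3,4) by simp
  moreover have "renorm r' t u_sym / 2 \<le> l"
    using renorm_mono_r[OF t assms(3,4), of u_sym] P by simp
  moreover have "renorm r' t u_alt / (2 + 4 * t) \<le> l"
    using renorm_mono_r[OF t assms(3,4), of u_alt] Q t by (simp add: field_simps)
  ultimately show ?thesis by simp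
qed

lemma eigenform_iff:
  assumes t: "0 \<le> t" and r: "rho < r"
  shows "eigenform r t l \<longleftrightarrow> (\<forall>u. renorm r t u = l * tri_form t (u 0) (u 1) (u 2))"
proof
  assume e: "eigenform r t l"
  show "\<forall>u. renorm r t u = l * tri_form t (u 0) (u 1) (u 2)"
  proof
    fix u :: "nat \<Rightarrow> real"
    have "renorm r t u = (u 0 - (u 1 + u 2) / 2)\<^sup>2 * (2 * l) + ((u 1 - u 2) / 2)\<^sup>2 * ((2 + 4 * t) * l)"
      using e unfolding eigenform_def renorm_decompose[OF t r, of u] by (simp only:)
    also have "\<dots> = l * tri_form t (u 0) (u 1) (u 2)"
      by (simp add: tri_form_def power2_eq_square field_simps)
    finally show "renorm r t u = l * tri_form t (u 0) (u 1) (u 2)" .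
  qed
next
  assume *: "\<forall>u. renorm r t u = l * tri_form t (u 0) (u 1) (u 2)"
  show "eigenform r t l"
    unfolding eigenform_def using t *[rule_format, of u_sym] *[rule_format, of u_alt]
    by (simp add: tri_form_def u_sym_def u_alt_def)
qed

text \<open>The competitor depends on the height alone, so horizontal edges carry nothing and the
  bound is uniform in t. Its values are 1 on level 0, 1/3 on level 1 and 0 below; the thresholds 4/5
  and 1/2 separate the heights 1, rho, rho^2. The energy is 2 (2/3)^2 + 4 (1/3)^2 / (9/10) = 112/81
  < 1.62.\<close>

lemma renorm_upper_end: "0 \<le> t \<Longrightarrow> renorm (9 / 10) t u_sym \<le> 2 * (9 / 10)\<^sup>2"
proof -
  assume t: "0 \<le> t"
  let ?r = "9 / 10 :: real"
  define f where "f z = (if hgt z > 4 / 5 then 1 else if hgt z > 1 / 2 then 1 / 3 else 0 :: real)" for z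
  have f0: "f (apex 0 b) = 1" and f1: "f (apex (Suc 0) b) = 1 / 3" for b
    using rho_gt rho_lt by (simp_all add: f_def)
  have f2: "f (apex (Suc (Suc n)) b) = 0" for n b
  proof -
    have "rho ^ Suc (Suc n) \<le> rho ^ 2"
      using rho_pos rho_less_1 by (intro power_decreasing) auto
    then show ?thesis using rho_gt by (simp add: f_def rho_sq del: power_Suc)
  qed
  have "card (B 1) = 2" using rho_pos by simp
  then have level_energy: "level_energy t f 0 = 8 / 9" "level_energy t f 1 = 4 / 9" "level_energy t f (Suc (Suc n)) = 0" for n
    by (simp_all add: level_energy_def cell_def f0 f1 f2 f2[of 0, simplified] tri_form_def power2_eq_square)
  have s: "(\<lambda>n. level_energy t f n / ?r ^ n) sums (\<Sum>n<2. level_energy t f n / ?r ^ n)"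
    by (rule sums_finite) (auto simp: not_less dest!: le_Suc_ex simp: level_energy)
  then have finite_energy: "finite_energy ?r t f" and energy: "energy ?r t f = 8 / 9 + 40 / 81"
    using level_energy(1,2) by (auto simp: finite_energy_def energy_def sums_iff numeral_2_eq_2)
  have "restricts_to f u_sym"
  proof (rule restricts_local[where f = "\<lambda>_. 0" and v = "\<lambda>_. 0" and c = "1 / 2"])
    show "restricts_to (\<lambda>_. 0) (\<lambda>_. 0)" by (simp add: restricts_to_iff)
    show "f (q 0) = u_sym 0" by (simp add: q0_apex f0 u_sym_def)
  qed (auto simp: f_def u_sym_def)
  then have "renorm ?r t u_sym \<le> 8 / 9 + 40 / 81"
    using renorm_le[OF t _ finite_energy] energy by simp
  then show ?thesis by (simp add: power2_eq_square)
qed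

section \<open>The eigenvalue near the golden ratio\<close>

text \<open>Thomson's principle on a single edge: voltage d, resistance s, trial current \<theta>,
  with equality for \<theta> = d / s. The lower bound is linear in the voltages, so the unknown
  potentials cancel when the currents form a flow.\<close>

lemma square_ge_tangent:
  fixes d s \<theta> :: real
  assumes "0 < s"
  shows "2 * \<theta> * d - \<theta>\<^sup>2 * s \<le> d\<^sup>2 / s"
proof -
  have "0 \<le> (d - \<theta> * s)\<^sup>2 / s" using assms by simp
  also have "\<dots> = d\<^sup>2 / s - (2 * \<theta> * d - \<theta>\<^sup>2 * s)"
    using assms by (simp add: power2_eq_square field_simps)
  finally show ?thesis by simp
qed

lemma sum_cells_le_lev:
  assumes "0 \<le> t" "S \<subseteq> B n"
  shows "(\<Sum>b\<in>S. cell t f n b) \<le> level_energy t f n"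
  unfolding level_energy_def using assms cell_nonneg by (intro sum_mono2) auto

text \<open>The left edge of the triangle has resistance 1 / (1 - r); at the golden ratio the two
  edges alone give exactly the bound 2 r^2.  A hexagon of edges parallel to the second
  segment of the left edge supplies the strict gain.\<close>

lemma hexagon_lev:
  fixes f :: "complex \<Rightarrow> real"
  defines "x \<equiv> \<lambda>n. f (apex n 0)" and "y \<equiv> \<lambda>n. f (apex n (1 - rho ^ n))"
    and "a \<equiv> f (apex 2 (rho ^ 3))" and "b \<equiv> f (apex 3 (rho ^ 3))"
    and "z \<equiv> f (apex 4 (rho ^ 3))" and "w \<equiv> f (apex 3 (rho ^ 4))"
  shows "(x n - x (Suc n))\<^sup>2 + (y n - y (Suc n))\<^sup>2 +
    (if n = 1 then (x 1 - a)\<^sup>2 else if n = 2 then (x 2 - w)\<^sup>2 + (a - b)\<^sup>2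
     else if n = 3 then (w - z)\<^sup>2 + (b - z)\<^sup>2 else 0) \<le> level_energy 0 f n"
proof -
  have bounds: "309 / 500 < rho" "rho < 31 / 50" by (rule rho_gt rho_lt)+
  note pw = rho_powers rho_sq
  let ?L = "(x n - x (Suc n))\<^sup>2" and ?R = "(y n - y (Suc n))\<^sup>2"
  have left: "?L \<le> cell 0 f n 0" using left_edge_le[of 0 f n 0] by (simp add: x_def)
  have right: "?R \<le> cell 0 f n (1 - rho ^ n)" using right_edge_top_le[of 0 f n] by (simp add: y_def)
  consider "n = 0" | "n = 1" | "n = 2" | "n = 3" | "n > 3" by linarith
  then show ?thesis
  proof cases
    case 1
    have "cell 0 f 0 0 = (x 0 - x 1)\<^sup>2 + (y 0 - y 1)\<^sup>2"
      by (simp add: cell_def tri_form_def x_def y_def rho_sq[unfolded power2_eq_square])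
    then show ?thesis using 1 by (simp add: level_energy_def)
  next
    case 2
    have "cell 0 f 1 0 = (x 1 - x 2)\<^sup>2 + (x 1 - a)\<^sup>2"
      unfolding cell_def tri_form_def x_def a_def by (simp del: One_nat_def)
    moreover have "(\<Sum>c\<in>{0, 1 - rho ^ n}. cell 0 f n c) \<le> level_energy 0 f n"
      by (rule sum_cells_le_lev) (auto simp del: B.simps simp: top_in_B)
    \<comment> \<open>The positions must be distinct for the sum over the set to count each cell
      separately; the later cases need the same check.\<close>
    moreover have "1 - rho ^ n \<noteq> 0" using 2 bounds by simp
    ultimately show ?thesis using 2 right by (simp del: One_nat_def)
  next
    case 3
    have "cell 0 f 2 0 = (x 2 - x 3)\<^sup>2 + (x 2 - w)\<^sup>2"
      unfolding cell_def tri_form_def x_def w_def by simp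
    moreover have "(a - b)\<^sup>2 \<le> cell 0 f 2 (rho ^ 3)"
      using left_edge_le[of 0 f 2 "rho ^ 3"] by (simp add: a_def b_def)
    moreover have "rho ^ 3 \<in> B 2" using B_right_child[of 0 1] by (simp add: numeral_2_eq_2 numeral_3_eq_3)
    then have "(\<Sum>c\<in>{0, 1 - rho ^ n, rho ^ 3}. cell 0 f n c) \<le> level_energy 0 f n"
      using 3 by (intro sum_cells_le_lev) (auto simp del: B.simps simp: top_in_B)
    moreover have "1 - rho ^ n \<noteq> 0" "rho ^ 3 \<noteq> 0" "1 - rho ^ n \<noteq> rho ^ 3"
      using 3 bounds pw by auto
    ultimately show ?thesis using 3 right by (simp add: insert_commute)
  next
    case 4
    have w: "(w - z)\<^sup>2 \<le> cell 0 f 3 (rho ^ 4)"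
    proof -
      \<comment> \<open>Here the hexagon closes: the right lower vertex of the cell at rho^4 is the
        left lower vertex of the cell at rho^3.\<close>
      have "rho ^ 4 + rho ^ 5 = rho ^ 3" by (simp add: pw)
      then show ?thesis using right_edge_le[of 0 f 3 "rho ^ 4"] by (simp add: w_def z_def)
    qed
    have b: "(b - z)\<^sup>2 \<le> cell 0 f 3 (rho ^ 3)"
      using left_edge_le[of 0 f 3 "rho ^ 3"] by (simp add: b_def z_def)
    have "rho ^ 3 \<in> B 2" using B_right_child[of 0 1] by (simp add: numeral_2_eq_2 numeral_3_eq_3)
    then have mem: "rho ^ 3 \<in> B 3" "rho ^ 4 \<in> B 3"
      using B_mono_Suc[of "rho ^ 3" 2] B_right_child[of 0 2] by (simp_all del: B.simps)
    have "(\<Sum>c\<in>{0, 1 - rho ^ n, rho ^ 3, rho ^ 4}. cell 0 f n c) \<le> level_energy 0 f n"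
      using 4 mem by (intro sum_cells_le_lev) (auto simp del: B.simps simp: top_in_B)
    moreover have "1 - rho ^ n \<noteq> 0" "rho ^ 3 \<noteq> 0" "1 - rho ^ n \<noteq> rho ^ 3" "rho ^ 4 \<noteq> 0"
      "rho ^ 3 \<noteq> rho ^ 4" "1 - rho ^ n \<noteq> rho ^ 4"
      using 4 bounds pw by auto
    ultimately have "cell 0 f n 0 + cell 0 f n (1 - rho ^ n) + cell 0 f n (rho ^ 3) + cell 0 f n (rho ^ 4) \<le> level_energy 0 f n"
      by simp
    then show ?thesis using 4 left right w b by simp
  next
    case 5
    have "(\<Sum>c\<in>{0, 1 - rho ^ n}. cell 0 f n c) \<le> level_energy 0 f n"
      by (rule sum_cells_le_lev) (auto simp del: B.simps simp: top_in_B)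
    moreover have "rho ^ n < rho ^ 0" using 5 unfolding rho_power_less by simp
    ultimately have "cell 0 f n 0 + cell 0 f n (1 - rho ^ n) \<le> level_energy 0 f n" by simp
    then show ?thesis using 5 left right by simp
  qed
qed

lemma renorm_lower_end: "2 * (31 / 50)\<^sup>2 \<le> renorm (31 / 50) 0 u_sym"
proof (rule renorm_ge)
  let ?r = "31 / 50 :: real"
  show "rho < ?r" by (rule rho_lt)
  fix f assume finite_energy: "finite_energy ?r 0 f" and restr: "restricts_to f u_sym"
  define x where "x n = f (apex n 0)" for n
  define y where "y n = f (apex n (1 - rho ^ n))" for n
  define a b z w where "a = f (apex 2 (rho ^ 3))" and "b = f (apex 3 (rho ^ 3))"
    and "z = f (apex 4 (rho ^ 3))" and "w = f (apex 3 (rho ^ 4))"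
  define right where "right n = (y n - y (Suc n))\<^sup>2 / ?r ^ n" for n
  define hex where "hex n = (if n = 1 then (x 1 - a)\<^sup>2 else if n = 2 then (x 2 - w)\<^sup>2 + (a - b)\<^sup>2
     else if n = 3 then (w - z)\<^sup>2 + (b - z)\<^sup>2 else 0) / ?r ^ n" for n :: nat
  \<comment> \<open>The share of the left edge, after the right edge and the rest of the hexagon
    have been removed from the level energy.\<close>
  define e where "e n = level_energy 0 f n / ?r ^ n - right n - hex n" for n
  have x0: "x 0 = 1" and y0: "y 0 = 1"
    using restr by (simp_all add: x_def y_def restricts_to_iff u_sym_def q0_apex)
  have xlim: "x \<longlonglongrightarrow> 0" and ylim: "y \<longlonglongrightarrow> 0"
    using restricts_to_edges[OF restr] unfolding x_def y_def by (simp_all add: u_sym_def)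
  have left_e: "(x n - x (Suc n))\<^sup>2 / ?r ^ n \<le> e n" for n
    using divide_right_mono[OF hexagon_lev[of f n], of "?r ^ n"]
    unfolding e_def right_def hex_def x_def y_def a_def b_def z_def w_def
    by (simp add: add_divide_distrib del: power_divide)
  have e0: "0 \<le> e n" for n
    by (rule order_trans[OF _ left_e]) simp
  have hex: "hex sums (\<Sum>n\<in>{1, 2, 3}. hex n)"
    by (rule sums_finite) (auto simp: hex_def)
  have hex0: "0 \<le> hex n" and right0: "0 \<le> right n" for n by (simp_all add: hex_def right_def)
  have sumE: "summable (\<lambda>n. level_energy 0 f n / ?r ^ n)" using finite_energy by (simp add: finite_energy_def)
  have sum_right: "summable right"
  proof (rule summable_comparison_test'[OF sumE])
    show "norm (right n) \<le> level_energy 0 f n / ?r ^ n" for n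
      using e0[of n] hex0[of n] right0[of n] unfolding e_def real_norm_def by linarith
  qed
  have sum_e: "summable e"
    unfolding e_def by (intro summable_diff sumE sum_right sums_summable[OF hex])
  have "energy ?r 0 f = suminf e + suminf right + suminf hex"
    unfolding energy_def e_def using sumE sum_right sums_summable[OF hex]
    by (simp add: suminf_diff[symmetric] summable_diff)
  moreover have "1 - ?r \<le> suminf right"
    using chain_bound[of ?r y 0 right, OF _ _ ylim sum_right] y0 by (simp add: right_def)
  moreover have "suminf hex = (x 1 - a)\<^sup>2 / ?r + ((x 2 - w)\<^sup>2 + (a - b)\<^sup>2) / ?r\<^sup>2 + ((w - z)\<^sup>2 + (b - z)\<^sup>2) / ?r ^ 3"
    using sums_unique[OF hex] by (simp add: hex_def)
  moreover have "(1 - x 1)\<^sup>2 + (x 1 - x 2)\<^sup>2 / ?r + (x 2)\<^sup>2 * (1 - ?r) / ?r\<^sup>2 \<le> suminf e"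
  proof -
    \<comment> \<open>From level 2 on, the left edge acts as one resistor of size r^2 / (1 -
      r).\<close>
    have "(x (0 + 2) - 0)\<^sup>2 * (1 - ?r) \<le> (\<Sum>n. ?r\<^sup>2 * e (n + 2))"
    proof (rule chain_bound)
      show "(\<lambda>n. x (n + 2)) \<longlonglongrightarrow> 0" by (rule LIMSEQ_ignore_initial_segment[OF xlim])
      show "summable (\<lambda>n. ?r\<^sup>2 * e (n + 2))"
        by (intro summable_mult summable_ignore_initial_segment sum_e)
      show "(x (n + 2) - x (Suc n + 2))\<^sup>2 / ?r ^ n \<le> ?r\<^sup>2 * e (n + 2)" for n
        using mult_left_mono[OF left_e[of "n + 2"], of "?r\<^sup>2"]
        by (simp add: power_add power_divide mult.commute)
    qed auto
    also have "\<dots> = ?r\<^sup>2 * (\<Sum>n. e (n + 2))"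
      by (intro suminf_mult summable_ignore_initial_segment sum_e)
    finally have "(x 2)\<^sup>2 * (1 - ?r) / ?r\<^sup>2 \<le> (\<Sum>n. e (n + 2))"
      by (simp add: field_simps numeral_2_eq_2)
    moreover have "suminf e = (\<Sum>n. e (n + 2)) + (e 0 + e 1)"
      using suminf_split_initial_segment[OF sum_e, of 2] by (simp add: numeral_2_eq_2)
    ultimately show ?thesis using left_e[of 0] left_e[of 1] x0 by (simp add: numeral_2_eq_2)
  qed
  \<comment> \<open>A flow of strength 2/5: at \<open>x 1\<close> it splits into 3/10 along the left
    edge and 1/10 through a, b, z, w, and reunites at \<open>x 2\<close>; negative currents mark
    edges run upwards. All potentials cancel, leaving 4/5 minus a dissipation of about 0.3963. With
    0.38 from the right edge this exceeds 0.7688.\<close>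
  moreover have "2 * (2/5) * (1 - x 1) - (2/5)\<^sup>2 * 1 \<le> (1 - x 1)\<^sup>2 / 1" by (rule square_ge_tangent) simp
  moreover have "2 * (3/10) * (x 1 - x 2) - (3/10)\<^sup>2 * ?r \<le> (x 1 - x 2)\<^sup>2 / ?r" by (rule square_ge_tangent) simp
  moreover have "2 * (1/10) * (x 1 - a) - (1/10)\<^sup>2 * ?r \<le> (x 1 - a)\<^sup>2 / ?r" by (rule square_ge_tangent) simp
  moreover have "2 * (1/10) * (a - b) - (1/10)\<^sup>2 * ?r\<^sup>2 \<le> (a - b)\<^sup>2 / ?r\<^sup>2" by (rule square_ge_tangent) simp
  moreover have "2 * (1/10) * (b - z) - (1/10)\<^sup>2 * ?r ^ 3 \<le> (b - z)\<^sup>2 / ?r ^ 3" by (rule square_ge_tangent) simp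
  moreover have "2 * (-1/10) * (w - z) - (-1/10)\<^sup>2 * ?r ^ 3 \<le> (w - z)\<^sup>2 / ?r ^ 3" by (rule square_ge_tangent) simp
  moreover have "2 * (-1/10) * (x 2 - w) - (-1/10)\<^sup>2 * ?r\<^sup>2 \<le> (x 2 - w)\<^sup>2 / ?r\<^sup>2" by (rule square_ge_tangent) simp
  moreover have "2 * (2/5) * x 2 - (2/5)\<^sup>2 * (?r\<^sup>2 / (1 - ?r)) \<le> (x 2)\<^sup>2 / (?r\<^sup>2 / (1 - ?r))"
    by (rule square_ge_tangent) simp
  ultimately show "2 * ?r\<^sup>2 \<le> energy ?r 0 f"
    by (simp add: power2_eq_square power3_eq_cube add_divide_distrib diff_divide_distrib; linarith)
qed simp

section \<open>Interpolation below a level\<close>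

declare B.simps [simp del]

definition node_below :: "nat \<Rightarrow> real \<Rightarrow> real" where
  "node_below N x = Max {b \<in> B N. b \<le> x}"

lemma node_below_props:
  assumes "0 \<le> x"
  shows "node_below N x \<in> B N" "node_below N x \<le> x" "\<And>c. c \<in> B N \<Longrightarrow> c \<le> x \<Longrightarrow> c \<le> node_below N x"
proof -
  have finite_energy: "finite {b \<in> B N. b \<le> x}" by simp
  have "0 \<in> {b \<in> B N. b \<le> x}" using assms by simp
  then have "node_below N x \<in> {b \<in> B N. b \<le> x}"
    unfolding node_below_def by (intro Max_in[OF finite_energy]) blast
  then show "node_below N x \<in> B N" "node_below N x \<le> x" by auto
  show "c \<le> node_below N x" if "c \<in> B N" "c \<le> x" for c
    unfolding node_below_def using finite_energy that by (intro Max_ge) auto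
qed

lemma node_below_eqI:
  assumes b: "b \<in> B N" "b \<le> x" and next_gt: "b = 1 - rho ^ N \<or> x < b + gap N b"
  shows "node_below N x = b"
proof (rule ccontr)
  assume "node_below N x \<noteq> b"
  have x: "0 \<le> x" using B_ge_0[OF b(1)] b(2) by simp
  have "b \<le> node_below N x" using node_below_props(3)[OF x b] .
  then have less: "b < node_below N x" using \<open>node_below N x \<noteq> b\<close> by simp
  then have "b \<noteq> 1 - rho ^ N" using B_le_top[OF node_below_props(1)[OF x, of N]] by linarith
  moreover have "b + gap N b \<le> node_below N x"
    by (rule gap_least[OF b(1) node_below_props(1)[OF x] less])
  then have "b + gap N b \<le> x" using node_below_props(2)[OF x, of N] by linarith
  ultimately show False using next_gt by auto
qed

lemma node_below_less_next:
  assumes "0 \<le> x" "node_below N x \<noteq> 1 - rho ^ N"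
  shows "x < node_below N x + gap N (node_below N x)"
proof (rule ccontr)
  assume "\<not> ?thesis"
  then have "node_below N x + gap N (node_below N x) \<le> node_below N x"
    by (intro node_below_props(3)[OF assms(1)] gap_next node_below_props(1) assms) simp
  then show False using gap_pos[of N "node_below N x"] by simp
qed

text \<open>Finer levels have positions to the right of the last node 1 - rho^N; there the last
  value is continued as a constant.\<close>

definition interp :: "nat \<Rightarrow> (real \<Rightarrow> real) \<Rightarrow> real \<Rightarrow> real" where
  "interp N h x = (let b = node_below N x in
     if b = 1 - rho ^ N then h b else h b + (h (b + gap N b) - h b) * ((x - b) / gap N b))"

lemma interp_top:
  assumes "1 - rho ^ N \<le> x"
  shows "interp N h x = h (1 - rho ^ N)"
  using node_below_eqI[OF top_in_B assms] by (simp add: interp_def Let_def)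

lemma interp_node:
  assumes "b \<in> B N"
  shows "interp N h b = h b"
  using node_below_eqI[OF assms order_refl] gap_pos[of N b] by (simp add: interp_def Let_def)

lemma interp_linear:
  assumes b: "b \<in> B N" "b \<noteq> 1 - rho ^ N" and x: "b \<le> x" "x \<le> b + gap N b"
  shows "interp N h x = h b + (h (b + gap N b) - h b) * ((x - b) / gap N b)"
proof (cases "x = b + gap N b")
  case True
  then show ?thesis using interp_node[OF gap_next[OF b], of h] gap_pos[of N b] by simp
next
  case False
  then have "node_below N x = b" using b x by (intro node_below_eqI) auto
  then show ?thesis using b by (simp add: interp_def Let_def)
qed

text \<open>The energy of row N regarded as a path of unit conductances, short and long gaps
  alike.\<close>

definition gap_energy :: "nat \<Rightarrow> (real \<Rightarrow> real) \<Rightarrow> real" where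
  "gap_energy N h = (\<Sum>b\<in>B N - {1 - rho ^ N}. (h (b + gap N b) - h b)\<^sup>2)"

text \<open>Linear interpolation spreads an increment evenly, so refining by k levels gains a
  factor rho^k.\<close>

lemma interp_energy:
  assumes "N \<le> n"
  shows "(\<Sum>b\<in>B n. (interp N h b - interp N h (b + rho ^ (n + 2)))\<^sup>2) \<le> rho ^ (n - N) * gap_energy N h"
proof -
  let ?\<eta> = "rho ^ (n + 2)" and ?T = "B N - {1 - rho ^ N}"
  define d where "d b = (interp N h b - interp N h (b + ?\<eta>))\<^sup>2" for b
  have \<eta>: "0 < ?\<eta>" using rho_pos by simp
  have step: "b + ?\<eta> \<le> \<beta> + gap N \<beta> \<and> d b = (h (\<beta> + gap N \<beta>) - h \<beta>)\<^sup>2 * (?\<eta> / gap N \<beta>)\<^sup>2"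
    if b: "b \<in> B n" and \<beta>: "node_below N b = \<beta>" "\<beta> \<noteq> 1 - rho ^ N" for b \<beta>
  proof -
    have b0: "0 \<le> b" by (rule B_ge_0[OF b])
    have \<beta>N: "\<beta> \<in> B N" "\<beta> \<le> b" using node_below_props[OF b0, of N] \<beta> by auto
    have "b < \<beta> + gap N \<beta>" using node_below_less_next[OF b0, of N] \<beta> by simp
    moreover have "\<beta> + gap N \<beta> \<in> B n" using gap_next[OF \<beta>N(1) \<beta>(2)] B_mono[OF assms] by blast
    \<comment> \<open>The right end of the gap is itself a position of level n, so by separation a
      step from b cannot jump over it.\<close>
    ultimately have le: "b + ?\<eta> \<le> \<beta> + gap N \<beta>" using B_separated b by (intro separatedD)
    have "interp N h (b + ?\<eta>) - interp N h b
        = (h (\<beta> + gap N \<beta>) - h \<beta>) * ((b + ?\<eta> - \<beta>) / gap N \<beta> - (b - \<beta>) / gap N \<beta>)"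
      using interp_linear[OF \<beta>N(1) \<beta>(2), of "b + ?\<eta>" h] interp_linear[OF \<beta>N(1) \<beta>(2) \<beta>N(2), of h]
        le \<eta> \<beta>N(2) by (simp add: right_diff_distrib)
    also have "(b + ?\<eta> - \<beta>) / gap N \<beta> - (b - \<beta>) / gap N \<beta> = ?\<eta> / gap N \<beta>"
      by (simp add: diff_divide_distrib[symmetric])
    finally have "d b = ((h (\<beta> + gap N \<beta>) - h \<beta>) * (?\<eta> / gap N \<beta>))\<^sup>2"
      unfolding d_def by (simp only: power2_commute[of "interp N h b"])
    then show ?thesis using le by (simp only: power_mult_distrib)
  qed
  have top: "d b = 0" if b: "b \<in> B n" "node_below N b = 1 - rho ^ N" for b
  proof -
    have "1 - rho ^ N \<le> b" using node_below_props(2)[OF B_ge_0[OF b(1)], of N] b(2) by simp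
    then show ?thesis using interp_top[of N b h] interp_top[of N "b + ?\<eta>" h] \<eta> by (simp add: d_def)
  qed
  have block: "(\<Sum>b\<in>{b\<in>B n. node_below N b = \<beta>}. d b) \<le> rho ^ (n - N) * (h (\<beta> + gap N \<beta>) - h \<beta>)\<^sup>2"
    if \<beta>: "\<beta> \<in> ?T" for \<beta>
  proof -
    let ?X = "{b\<in>B n. node_below N b = \<beta>}" and ?\<delta> = "(h (\<beta> + gap N \<beta>) - h \<beta>)\<^sup>2" and ?g = "gap N \<beta>"
    have g: "0 < ?g" by (rule gap_pos)
    \<comment> \<open>At most g / \<eta> steps start in a gap of length g, each contributing
      \<open>?\<delta>\<close> * (\<eta> / g)^2. The total is at most \<open>?\<delta>\<close> *
      \<eta> / g, and g is at least rho^(N+2).\<close>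
    have "real (card ?X) * ?\<eta> \<le> \<beta> + ?g - \<beta>"
    proof (rule card_separated_le)
      show "separated ?\<eta> ?X" using B_separated[of n] by (auto simp: separated_def)
      show "\<beta> \<le> b" if "b \<in> ?X" for b
        using that node_below_props(2)[OF B_ge_0, of b n N] by auto
      show "b + ?\<eta> \<le> \<beta> + ?g" if "b \<in> ?X" for b using that step \<beta> by blast
    qed (use g in auto)
    then have card: "real (card ?X) * ?\<eta> \<le> ?g" by simp
    have "(\<Sum>b\<in>?X. d b) = (\<Sum>b\<in>?X. ?\<delta> * (?\<eta> / ?g)\<^sup>2)"
      by (rule sum.cong) (use step \<beta> in auto)
    also have "\<dots> = (real (card ?X) * ?\<eta>) * (?\<delta> * ?\<eta> / ?g\<^sup>2)"
      by (simp add: power2_eq_square)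
    also have "\<dots> \<le> ?g * (?\<delta> * ?\<eta> / ?g\<^sup>2)"
      using \<eta> by (intro mult_right_mono card) simp
    also have "\<dots> = (?\<eta> / ?g) * ?\<delta>" using g by (simp add: power2_eq_square)
    also have "?\<eta> / ?g \<le> ?\<eta> / rho ^ (N + 2)"
      using \<eta> rho_pos gap_ge by (intro divide_left_mono mult_pos_pos g) auto
    also have "?\<eta> / rho ^ (N + 2) = rho ^ (n - N)"
      using assms rho_pos by (simp add: power_diff)
    finally show ?thesis by (simp add: mult_right_mono)
  qed
  have "(\<Sum>b\<in>B n. d b) = (\<Sum>\<beta>\<in>B N. \<Sum>b\<in>{b\<in>B n. node_below N b = \<beta>}. d b)"
    using node_below_props(1)[OF B_ge_0] by (intro sum.group[symmetric]) auto
  also have "\<dots> = (\<Sum>\<beta>\<in>?T. \<Sum>b\<in>{b\<in>B n. node_below N b = \<beta>}. d b)"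
    using top by (intro sum.mono_neutral_right) (auto intro!: sum.neutral)
  also have "\<dots> \<le> (\<Sum>\<beta>\<in>?T. rho ^ (n - N) * (h (\<beta> + gap N \<beta>) - h \<beta>)\<^sup>2)"
    by (rule sum_mono[OF block])
  finally show ?thesis by (simp add: d_def gap_energy_def sum_distrib_left)
qed

text \<open>Long gaps are bridged by the common parent, short gaps by the common child.\<close>

lemma gap_energy_le:
  assumes t: "0 \<le> t"
  shows "gap_energy (Suc m) (\<lambda>b. f (apex (Suc m) b)) \<le> 2 * (level_energy t f m + level_energy t f (Suc m))"
proof -
  let ?N = "Suc m"
  define h where "h b = f (apex ?N b)" for b
  let ?\<eta> = "rho ^ (?N + 2)"
  define S where "S = {b \<in> B ?N. b + ?\<eta> \<in> B ?N}"
  define L where "L = {b \<in> B ?N. b \<noteq> 1 - rho ^ ?N \<and> b + ?\<eta> \<notin> B ?N}"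
  define R where "R b = (f (apex ?N b) - f (apex (Suc ?N) (b + ?\<eta>)))\<^sup>2" for b
  define Q where "Q b = (f (apex ?N b) - f (apex (Suc ?N) b))\<^sup>2" for b
  have sq: "(p - q)\<^sup>2 \<le> 2 * (v - p)\<^sup>2 + 2 * (v - q)\<^sup>2" for p q v :: real
    using zero_le_power2[of "(v - p) + (v - q)"] by (simp add: power2_eq_square algebra_simps)
  have finite_energy: "finite S" "finite L" by (simp_all add: S_def L_def)
  have "?\<eta> \<noteq> 0" using rho_pos by simp
  have not_top: "b \<noteq> 1 - rho ^ ?N" if "b \<in> S" for b
  proof
    assume "b = 1 - rho ^ ?N"
    moreover have "b + ?\<eta> \<in> B ?N" using that by (simp only: S_def mem_Collect_eq)
    moreover have "0 < ?\<eta>" using rho_pos by (rule zero_less_power)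
    ultimately show False using B_le_top[of "b + ?\<eta>" ?N] by linarith
  qed
  have "B ?N - {1 - rho ^ ?N} = S \<union> L" "S \<inter> L = {}"
    using not_top by (auto simp: S_def L_def simp del: B.simps)
  then have "gap_energy ?N h = (\<Sum>b\<in>S. (h (b + gap ?N b) - h b)\<^sup>2) + (\<Sum>b\<in>L. (h (b + gap ?N b) - h b)\<^sup>2)"
    unfolding gap_energy_def using finite_energy by (simp add: sum.union_disjoint)
  moreover have "(\<Sum>b\<in>S. (h (b + gap ?N b) - h b)\<^sup>2) \<le> 2 * level_energy t f ?N"
  proof -
    have "(\<Sum>b\<in>S. (h (b + gap ?N b) - h b)\<^sup>2) \<le> (\<Sum>b\<in>S. 2 * R b + 2 * Q (b + ?\<eta>))"
    proof (rule sum_mono)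
      fix b assume "b \<in> S"
      then have "gap ?N b = ?\<eta>" by (simp add: S_def gap_def)
      then show "(h (b + gap ?N b) - h b)\<^sup>2 \<le> 2 * R b + 2 * Q (b + ?\<eta>)"
        using sq[of "h b" "h (b + ?\<eta>)" "f (apex (Suc ?N) (b + ?\<eta>))"]
        unfolding R_def Q_def h_def by (simp only: power2_commute)
    qed
    \<comment> \<open>The shift sends \<open>S\<close> injectively into the row, so every left edge
      is charged at most once, and R b + Q b fits into the energy of the cell at b.\<close>
    also have "\<dots> = 2 * (\<Sum>b\<in>S. R b) + 2 * (\<Sum>b\<in>(\<lambda>b. b + ?\<eta>) ` S. Q b)"
      by (subst sum.reindex) (auto simp: inj_on_def sum.distrib sum_distrib_left)
    also have "\<dots> \<le> 2 * (\<Sum>b\<in>B ?N. R b) + 2 * (\<Sum>b\<in>B ?N. Q b)"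
      by (intro add_mono mult_left_mono sum_mono2 finite_B) (auto simp: S_def R_def Q_def simp del: B.simps)
    also have "\<dots> = 2 * (\<Sum>b\<in>B ?N. R b + Q b)" by (simp only: sum.distrib distrib_left)
    also have "\<dots> \<le> 2 * level_energy t f ?N"
      unfolding level_energy_def using t
      by (intro mult_left_mono sum_mono) (auto simp: R_def Q_def cell_def tri_form_def)
    finally show ?thesis .
  qed
  moreover have "(\<Sum>b\<in>L. (h (b + gap ?N b) - h b)\<^sup>2) \<le> 2 * level_energy t f m"
  proof -
    have Lm: "L \<subseteq> B m"
      using long_gap_parent[of _ m] by (auto simp: L_def numeral_3_eq_3 simp del: B.simps)
    have "(\<Sum>b\<in>L. (h (b + gap ?N b) - h b)\<^sup>2) \<le> (\<Sum>b\<in>L. 2 * cell t f m b)"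
    proof (rule sum_mono)
      fix b assume "b \<in> L"
      then have g: "gap ?N b = rho ^ (m + 2)" by (simp add: L_def gap_def)
      have "(h (b + gap ?N b) - h b)\<^sup>2 \<le> 2 * (f (apex m b) - h (b + rho ^ (m + 2)))\<^sup>2 + 2 * (f (apex m b) - h b)\<^sup>2"
        unfolding g by (rule sq)
      also have "\<dots> \<le> 2 * cell t f m b"
        using t by (simp add: cell_def tri_form_def h_def)
      finally show "(h (b + gap ?N b) - h b)\<^sup>2 \<le> 2 * cell t f m b" .
    qed
    also have "\<dots> \<le> 2 * level_energy t f m"
      unfolding level_energy_def sum_distrib_left[symmetric] using Lm t
      by (intro mult_left_mono sum_mono2) (auto simp: cell_nonneg)
    finally show ?thesis .
  qed
  ultimately have "gap_energy ?N h \<le> 2 * (level_energy t f m + level_energy t f ?N)" by simp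
  moreover have "h = (\<lambda>b. f (apex ?N b))" by (simp add: h_def fun_eq_iff)
  ultimately show ?thesis by simp
qed

text \<open>The threshold rho^(N+1) keeps all levels up to N; on level N both branches agree. Below,
  the value depends on the position alone, so left edges carry nothing while right and horizontal
  edges have equal increments, whence the factor 1 + t in the energy estimate.\<close>

definition smooth :: "nat \<Rightarrow> (complex \<Rightarrow> real) \<Rightarrow> complex \<Rightarrow> real" where
  "smooth N f z = (if rho ^ Suc N < hgt z then f z else interp N (\<lambda>b. f (apex N b)) (pos z))"

lemma smooth_upper: "n \<le> N \<Longrightarrow> smooth N f (apex n b) = f (apex n b)"
  by (simp add: smooth_def rho_power_less del: power_Suc)

lemma smooth_lower: "N \<le> n \<Longrightarrow> b \<in> B n \<Longrightarrow> smooth N f (apex n b) = interp N (\<lambda>b. f (apex N b)) b"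
  by (cases "n = N") (simp_all add: smooth_def rho_power_less interp_node del: power_Suc)

lemma level_energy_smooth_upper:
  assumes "n < N"
  shows "level_energy t (smooth N f) n = level_energy t f n"
  using assms by (simp add: level_energy_def cell_def smooth_upper)

lemma level_energy_smooth_lower:
  assumes n: "N \<le> n" and t: "0 \<le> t"
  shows "level_energy t (smooth N f) n \<le> (1 + t) * rho ^ (n - N) * gap_energy N (\<lambda>b. f (apex N b))"
proof -
  let ?h = "\<lambda>b. f (apex N b)"
  have "level_energy t (smooth N f) n = (\<Sum>b\<in>B n. (1 + t) * (interp N ?h b - interp N ?h (b + rho ^ (n + 2)))\<^sup>2)"
    unfolding level_energy_def
  proof (rule sum.cong[OF refl])
    fix b assume b: "b \<in> B n"
    have "smooth N f (apex n b) = interp N ?h b" "smooth N f (apex (Suc n) b) = interp N ?h b"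
      "smooth N f (apex (Suc n) (b + rho ^ (n + 2))) = interp N ?h (b + rho ^ (n + 2))"
      using n b B_mono_Suc[OF b] B_right_child[OF b] by (intro smooth_lower; simp del: B.simps)+
    then show "cell t (smooth N f) n b = (1 + t) * (interp N ?h b - interp N ?h (b + rho ^ (n + 2)))\<^sup>2"
      by (simp add: cell_def tri_form_def distrib_right)
  qed
  also have "\<dots> \<le> (1 + t) * (rho ^ (n - N) * gap_energy N ?h)"
    unfolding sum_distrib_left[symmetric] using interp_energy[OF n, of ?h] t by (intro mult_left_mono) auto
  finally show ?thesis by simp
qed

lemma gap_energy_nonneg: "0 \<le> gap_energy N h"
  by (simp add: gap_energy_def sum_nonneg)

text \<open>From level N on there is a geometric series of ratio rho / r. The bound involves
  finitely many levels of f and one row, so it is available even when f has infinite energy for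
  r.\<close>

lemma smooth_energy:
  assumes t: "0 \<le> t" and r: "rho < r"
  shows "finite_energy r t (smooth N f)"
    "energy r t (smooth N f) \<le> (\<Sum>n<N. level_energy t f n / r ^ n)
      + (1 + t) * gap_energy N (\<lambda>b. f (apex N b)) / r ^ N / (1 - rho / r)"
proof -
  let ?x = "rho / r" and ?G = "gap_energy N (\<lambda>b. f (apex N b))"
  have r0: "0 < r" using r rho_pos by simp
  have x: "0 < ?x" "?x < 1" using r r0 rho_pos by auto
  let ?l = "\<lambda>n. level_energy t (smooth N f) n / r ^ n"
  let ?c = "(1 + t) * ?G / r ^ N"
  have le: "?l (n + N) \<le> ?c * ?x ^ n" for n
    using divide_right_mono[OF level_energy_smooth_lower[of N "n + N" t f], of "r ^ (n + N)"] t r0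
    by (simp add: power_add power_divide mult.commute mult.left_commute)
  have geo: "(\<lambda>n. ?c * ?x ^ n) sums (?c * (1 / (1 - ?x)))"
    using x by (intro sums_mult geometric_sums) (simp only: real_norm_def abs_of_pos)
  have "summable (\<lambda>n. ?l (n + N))"
    using le level_energy_nonneg[OF t] r0 by (intro summable_comparison_test'[OF sums_summable[OF geo]]) simp
  then have sum: "summable ?l" by (rule summable_iff_shift[of ?l N, THEN iffD1])
  then show "finite_energy r t (smooth N f)" by (simp add: finite_energy_def)
  have "(\<Sum>n. ?l (n + N)) \<le> ?c * (1 / (1 - ?x))"
    using suminf_le[OF le summable_ignore_initial_segment[OF sum] sums_summable[OF geo]] sums_unique[OF geo] by simp
  moreover have "energy r t (smooth N f) = (\<Sum>n. ?l (n + N)) + (\<Sum>n<N. ?l n)"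
    unfolding energy_def by (rule suminf_split_initial_segment[OF sum])
  moreover have "(\<Sum>n<N. ?l n) = (\<Sum>n<N. level_energy t f n / r ^ n)"
    by (intro sum.cong) (auto simp: level_energy_smooth_upper)
  ultimately show "energy r t (smooth N f) \<le> (\<Sum>n<N. level_energy t f n / r ^ n) + ?c / (1 - ?x)" by simp
qed

text \<open>Near q_1 the function is linear in \<open>pos\<close> on the first gap, near q_2 it is
  the constant beyond the top. Its corner values are therefore those of f on row N, not the limits
  of f.\<close>

lemma restricts_smooth:
  assumes N: "0 < N" and v: "v 0 = f (q 0)" "v 1 = f (apex N 0)" "v 2 = f (apex N (1 - rho ^ N))"
  shows "restricts_to (smooth N f) v"
  unfolding restricts_to_iff
proof (intro conjI)
  show "smooth N f (q 0) = v 0" using smooth_upper[of 0 N f 0] v by (simp add: q0_apex)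
  have low: "eventually (\<lambda>z. hgt z < rho ^ Suc N) (at w within V1)" if "hgt w = 0" for w
  proof -
    have "((\<lambda>z. hgt z) \<longlongrightarrow> hgt w) (at w within V1)" by (intro tendsto_intros)
    then show ?thesis using that rho_pos by (intro order_tendstoD(2)[of _ "hgt w"]) auto
  qed
  have inV1: "eventually (\<lambda>z. z \<in> V1) (at w within V1)" for w
    by (simp add: eventually_at_filter)
  have pos: "((\<lambda>z. pos z) \<longlongrightarrow> pos w) (at w within V1)" for w by (intro tendsto_intros)
  let ?h = "\<lambda>b. f (apex N b)"
  have top0: "0 \<noteq> 1 - rho ^ N" using rho_power_less[of N 0] N by simp
  show "(smooth N f \<longlongrightarrow> v 1) (at 0 within V1)"
  proof (rule Lim_transform_eventually)
    have "((\<lambda>z. ?h 0 + (?h (0 + gap N 0) - ?h 0) * ((pos z - 0) / gap N 0)) \<longlongrightarrow>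
        ?h 0 + (?h (0 + gap N 0) - ?h 0) * ((pos 0 - 0) / gap N 0)) (at 0 within V1)"
      using gap_pos[of N 0] by (intro tendsto_intros) auto
    then show "((\<lambda>z. ?h 0 + (?h (0 + gap N 0) - ?h 0) * ((pos z - 0) / gap N 0)) \<longlongrightarrow> v 1) (at 0 within V1)"
      by (simp add: v del: One_nat_def)
    have "eventually (\<lambda>z. pos z < gap N 0) (at 0 within V1)"
      using order_tendstoD(2)[OF pos, of 0] gap_pos by simp
    with low[of 0, simplified] inV1
    show "eventually (\<lambda>z. ?h 0 + (?h (0 + gap N 0) - ?h 0) * ((pos z - 0) / gap N 0) = smooth N f z) (at 0 within V1)"
    proof eventually_elim
      case (elim z)
      then have "0 \<le> pos z" using B_ge_0 by (auto elim!: V1_cases)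
      then show ?case
        using interp_linear[OF zero_in_B top0, of "pos z" ?h] elim by (simp add: smooth_def)
    qed
  qed
  show "(smooth N f \<longlongrightarrow> v 2) (at 1 within V1)"
  proof (rule Lim_transform_eventually[OF tendsto_const])
    have "eventually (\<lambda>z. 1 - rho ^ N < pos z) (at 1 within V1)"
      using order_tendstoD(1)[OF pos, of "1 - rho ^ N" 1] rho_pos by simp
    with low[of 1, simplified]
    show "eventually (\<lambda>z. v 2 = smooth N f z) (at 1 within V1)"
      by eventually_elim (simp add: smooth_def interp_top v)
  qed
qed

section \<open>Continuity in the scaling factor\<close>

text \<open>Young's inequality on every edge. A small weight k keeps the factor of the main part
  near 1, at the price of the large factor 1 + 1/k on an exponentially small correction.\<close>

lemma energy_add_le:
  assumes t: "0 \<le> t" and r: "0 < r" and f: "finite_energy r t f" and g: "finite_energy r t g" and k: "0 < k"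
  shows "finite_energy r t (\<lambda>z. f z + g z)" "energy r t (\<lambda>z. f z + g z) \<le> (1 + k) * energy r t f + (1 + 1 / k) * energy r t g"
proof -
  show finite_energy: "finite_energy r t (\<lambda>z. f z + g z)"
    using energy_parallelogram(1)[OF t r f g, of 1 1 0] by simp
  have sq: "(p + q)\<^sup>2 \<le> (1 + k) * p\<^sup>2 + (1 + 1 / k) * q\<^sup>2" for p q :: real
  proof -
    have "0 \<le> (k * p - q)\<^sup>2 / k" using k by simp
    also have "\<dots> = (1 + k) * p\<^sup>2 + (1 + 1 / k) * q\<^sup>2 - (p + q)\<^sup>2"
      using k by (simp add: power2_eq_square field_simps)
    finally show ?thesis by simp
  qed
  have cell: "cell t (\<lambda>z. f z + g z) n b \<le> (1 + k) * cell t f n b + (1 + 1 / k) * cell t g n b" for n b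
  proof -
    have split: "(x + x') - (y + y') = (x - y) + (x' - y')" for x x' y y' :: real by simp
    have "cell t (\<lambda>z. f z + g z) n b \<le>
      ((1 + k) * (f (apex n b) - f (apex (Suc n) b))\<^sup>2 + (1 + 1 / k) * (g (apex n b) - g (apex (Suc n) b))\<^sup>2) +
      ((1 + k) * (f (apex n b) - f (apex (Suc n) (b + rho ^ (n + 2))))\<^sup>2 +
       (1 + 1 / k) * (g (apex n b) - g (apex (Suc n) (b + rho ^ (n + 2))))\<^sup>2) +
      t * ((1 + k) * (f (apex (Suc n) b) - f (apex (Suc n) (b + rho ^ (n + 2))))\<^sup>2 +
       (1 + 1 / k) * (g (apex (Suc n) b) - g (apex (Suc n) (b + rho ^ (n + 2))))\<^sup>2)"
      unfolding cell_def tri_form_def split by (intro add_mono mult_left_mono sq t)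
    also have "\<dots> = (1 + k) * cell t f n b + (1 + 1 / k) * cell t g n b"
      unfolding cell_def tri_form_def by (simp only: distrib_left mult.left_commute add_ac)
    finally show ?thesis .
  qed
  let ?s = "\<lambda>n. (1 + k) * (level_energy t f n / r ^ n) + (1 + 1 / k) * (level_energy t g n / r ^ n)"
  have level_energy: "level_energy t (\<lambda>z. f z + g z) n / r ^ n \<le> ?s n" for n
  proof -
    have "level_energy t (\<lambda>z. f z + g z) n \<le> (1 + k) * level_energy t f n + (1 + 1 / k) * level_energy t g n"
      unfolding level_energy_def sum_distrib_left sum.distrib[symmetric] by (rule sum_mono[OF cell])
    from divide_right_mono[OF this, of "r ^ n"] r show ?thesis
      by (simp only: add_divide_distrib times_divide_eq_right zero_le_power less_imp_le)
  qed
  have "energy r t (\<lambda>z. f z + g z) \<le> suminf ?s"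
    unfolding energy_def using finite_energy f g
    by (intro suminf_le[OF level_energy] summable_add summable_mult) (simp_all only: finite_energy_def)
  also have "\<dots> = (1 + k) * energy r t f + (1 + 1 / k) * energy r t g"
    unfolding energy_def using f g
    by (subst suminf_add[symmetric]) (simp_all only: finite_energy_def summable_mult suminf_mult)
  finally show "energy r t (\<lambda>z. f z + g z) \<le> (1 + k) * energy r t f + (1 + 1 / k) * energy r t g" .
qed

text \<open>Pigeonhole: the M pair sums in the window add up to at most 2 K. A pair is needed
  because the gap energy of row m + 1 is controlled by levels m and m + 1.\<close>

lemma small_consecutive_pair:
  fixes e :: "nat \<Rightarrow> real"
  assumes sum: "summable e" and nn: "\<And>n. 0 \<le> e n" and K: "suminf e \<le> K" and M: "0 < M"
  obtains m where "M \<le> m" "m < 2 * M" "e m + e (Suc m) \<le> 2 * K / real M"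
proof -
  have "\<exists>m\<in>{M..<2 * M}. e m + e (Suc m) \<le> 2 * K / real M"
  proof (rule ccontr)
    assume "\<not> ?thesis"
    then have less: "\<And>m. m \<in> {M..<2 * M} \<Longrightarrow> 2 * K / real M < e m + e (Suc m)"
      by (meson not_le)
    have "(\<Sum>m\<in>{M..<2 * M}. 2 * K / real M) < (\<Sum>m\<in>{M..<2 * M}. e m + e (Suc m))"
      using M by (intro sum_strict_mono less) auto
    also have "\<dots> = sum e {M..<2 * M} + sum e {Suc M..<Suc (2 * M)}"
      by (simp add: sum.distrib sum.shift_bounds_Suc_ivl del: sum.op_ivl_Suc)
    also have "\<dots> \<le> suminf e + suminf e"
      by (intro add_mono sum_le_suminf sum) (auto simp: nn)
    finally show False using K M by simp
  qed
  then show thesis using that by auto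
qed

text \<open>The competitor for r is \<open>smooth N f\<close> plus an affine correction of the
  corner values. With M < N <= 2 M the weights of the kept levels change by at most (r' / r)^(2 M),
  the levels below are cheap by the choice of N, and the correction decays like rb^M. The weight 1/M
  in \<open>energy_add_le\<close> lets all losses vanish as M grows with r' / r close enough to
  1.\<close>

lemma renorm_step_bound:
  fixes M :: nat
  assumes t: "0 \<le> t" and ra: "rho < ra" "ra \<le> r" and rr: "r \<le> r'" and rb: "r' \<le> rb" "rb < 1"
    and f: "finite_energy r' t f" "restricts_to f u" and K: "energy r' t f \<le> K" and M: "0 < M"
  shows "renorm r t u \<le> (1 + 1 / M) * ((r' / r) ^ (2 * M) * (K + 8 * (1 + t) / (1 - rho / ra) * K / M))
    + (1 + M) * (2 * (1 + 2 * t) / ((1 - rb) * (1 - rho / ra)) * K * rb ^ M)"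
proof -
  have r: "rho < r" "0 < r" "0 < r'" "r' < 1" "0 < ra" "0 < rb" "1 / 2 < r'"
    using ra rr rb rho_pos rho_gt by auto
  define s where "s = r' / r"
  have s: "1 \<le> s" "0 < s" using r rr by (auto simp: s_def)
  define \<theta> where "\<theta> = 1 - rho / ra"
  have \<theta>: "0 < \<theta>" using ra(1) r(5) by (simp add: \<theta>_def)
  have \<theta>r: "\<theta> \<le> 1 - rho / r"
    using ra r rho_pos by (auto simp: \<theta>_def intro!: divide_left_mono)
  define e where "e n = level_energy t f n / r' ^ n" for n
  have e: "summable e" "suminf e \<le> K" using f K unfolding e_def by (simp_all add: finite_energy_def energy_def)
  have e0: "0 \<le> e n" for n using level_energy_nonneg[OF t] r by (simp add: e_def)
  have K0: "0 \<le> K" using suminf_nonneg[OF e(1) e0] e(2) by simp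
  obtain m where m: "M \<le> m" "m < 2 * M" "e m + e (Suc m) \<le> 2 * K / real M"
    using small_consecutive_pair[OF e(1) e0 e(2) M] by blast
  define N where "N = Suc m"
  have N: "0 < N" "M \<le> N" "N \<le> 2 * M" using m by (auto simp: N_def)
  have level_energy: "level_energy t f n / r ^ n = e n * s ^ n" for n
    using r by (simp add: e_def s_def power_divide)
  have spow: "s ^ n \<le> s ^ (2 * M)" if "n \<le> 2 * M" for n using that s by (intro power_increasing)
  have "(\<Sum>n<N. level_energy t f n / r ^ n) \<le> (\<Sum>n<N. e n * s ^ (2 * M))"
    unfolding level_energy using N e0 spow by (intro sum_mono mult_left_mono) auto
  also have "\<dots> = s ^ (2 * M) * (\<Sum>n<N. e n)" by (simp add: sum_distrib_right mult.commute)
  also have "\<dots> \<le> s ^ (2 * M) * K"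
    using sum_le_suminf[OF e(1), of "{..<N}"] e0 e(2) s by (intro mult_left_mono) auto
  finally have upper: "(\<Sum>n<N. level_energy t f n / r ^ n) \<le> s ^ (2 * M) * K" .
  let ?G = "gap_energy N (\<lambda>b. f (apex N b))"
  have "?G / r ^ N \<le> 2 * (level_energy t f m + level_energy t f N) / r ^ N"
    using gap_energy_le[OF t, of m f] r by (simp add: N_def divide_right_mono)
  also have "\<dots> = 2 * (e m * s ^ N / r' + e N * s ^ N)"
    using level_energy[of N] r by (simp add: add_divide_distrib e_def s_def N_def power_divide)
  \<comment> \<open>Level m is divided by r^N instead of r^m r, which after rescaling leaves 1 / r';
    this is below 2 as r' > 1/2.\<close>
  also have "e m * s ^ N / r' \<le> 2 * (e m * s ^ N)"
  proof -
    have "e m * s ^ N * 1 \<le> e m * s ^ N * (2 * r')"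
      using r e0[of m] s by (intro mult_left_mono mult_nonneg_nonneg) auto
    then show ?thesis using r by (simp add: pos_divide_le_eq mult_ac)
  qed
  also have "2 * (2 * (e m * s ^ N) + e N * s ^ N) \<le> 4 * s ^ N * (e m + e N)"
    using e0[of N] s by (simp add: algebra_simps)
  also have "\<dots> \<le> 4 * s ^ (2 * M) * (2 * K / M)"
    using m(3) e0 spow[OF N(3)] s by (intro mult_mono) (auto simp: N_def)
  finally have G: "?G / r ^ N \<le> s ^ (2 * M) * (8 * K / M)" by (simp add: mult_ac)
  have "(1 + t) * ?G / r ^ N / (1 - rho / r) \<le> (1 + t) * (?G / r ^ N) / \<theta>"
    using \<theta> \<theta>r t r gap_energy_nonneg[of N "\<lambda>b. f (apex N b)"] by (simp add: divide_left_mono)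
  also have "\<dots> \<le> (1 + t) * (s ^ (2 * M) * (8 * K / M)) / \<theta>"
    using G t \<theta> by (intro divide_right_mono mult_left_mono) auto
  also have "\<dots> = s ^ (2 * M) * (8 * (1 + t) / \<theta> * K / M)" by (simp add: mult_ac)
  finally have lower: "(1 + t) * ?G / r ^ N / (1 - rho / r) \<le> s ^ (2 * M) * (8 * (1 + t) / \<theta> * K / M)" .
  note smooth = smooth_energy[OF t r(1), of N f]
  have energy_smooth: "energy r t (smooth N f) \<le> s ^ (2 * M) * (K + 8 * (1 + t) / \<theta> * K / M)"
    using smooth(2) upper lower by (simp add: distrib_left)
  define v where "v i = (if i = 0 then f (q 0) else if i = 1 then f (apex N 0) else f (apex N (1 - rho ^ N)))" for i :: nat
  define w where "w i = u i - v i" for i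
  have "restricts_to (smooth N f) v" by (rule restricts_smooth[OF N(1)]) (simp_all add: v_def)
  from restricts_cong[OF restricts_linear[OF this restricts_aff[of w], of 1 1 0], where v = u]
  have restr: "restricts_to (\<lambda>z. smooth N f z + aff w z) u" by (simp add: w_def)
  have rbN: "r' ^ N \<le> rb ^ M"
    by (rule order_trans[OF power_mono power_decreasing]) (use N r rb in auto)
  have corner: "x\<^sup>2 \<le> rb ^ M * K / (1 - rb)" if "x\<^sup>2 * (1 - r') \<le> r' ^ N * energy r' t f" for x
  proof -
    have "x\<^sup>2 * (1 - rb) \<le> x\<^sup>2 * (1 - r')" using rb by (intro mult_left_mono) auto
    also have "\<dots> \<le> r' ^ N * energy r' t f" by (rule that)
    also have "\<dots> \<le> rb ^ M * K"
      using rbN K energy_nonneg[OF t r(3) f(1)] r by (intro mult_mono) auto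
    finally show ?thesis using rb by (simp add: pos_le_divide_eq)
  qed
  have w0: "w 0 = 0" using f(2) by (simp add: w_def v_def restricts_to_iff)
  have w1: "(w 1)\<^sup>2 \<le> rb ^ M * K / (1 - rb)"
    using corner[OF left_corner_bound[OF t r(3,4) f]] by (simp add: w_def v_def power2_commute)
  have w2: "(w 2)\<^sup>2 \<le> rb ^ M * K / (1 - rb)"
    using corner[OF right_corner_bound[OF t r(3,4) f]] by (simp add: w_def v_def power2_commute)
  have "tri_form t (w 0) (w 1) (w 2) \<le> (1 + 2 * t) * tri_form 0 (w 0) (w 1) (w 2)"
    using tri_form_lipschitz[of 0 t] t by simp
  also have "\<dots> \<le> (1 + 2 * t) * (2 * (rb ^ M * K / (1 - rb)))"
  proof (rule mult_left_mono)
    have "tri_form 0 (w 0) (w 1) (w 2) = (w 1)\<^sup>2 + (w 2)\<^sup>2" unfolding tri_form_def w0 by simp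
    then show "tri_form 0 (w 0) (w 1) (w 2) \<le> 2 * (rb ^ M * K / (1 - rb))"
      using add_mono[OF w1 w2] by (simp only: mult_2)
  qed (use t in simp)
  finally have Dw: "tri_form t (w 0) (w 1) (w 2) \<le> (1 + 2 * t) * (2 * (rb ^ M * K / (1 - rb)))" .
  note aff = aff_energy[OF t r(1), of w]
  have "energy r t (aff w) \<le> tri_form t (w 0) (w 1) (w 2) / \<theta>"
    using aff(2) divide_left_mono[OF \<theta>r tri_form_nonneg[OF t, of "w 0" "w 1" "w 2"]] \<theta> \<theta>r by (smt (verit) mult_pos_pos)
  also have "\<dots> \<le> (1 + 2 * t) * (2 * (rb ^ M * K / (1 - rb))) / \<theta>"
    by (rule divide_right_mono[OF Dw less_imp_le[OF \<theta>]])
  also have "\<dots> = 2 * (1 + 2 * t) / ((1 - rb) * \<theta>) * K * rb ^ M" by (simp add: mult_ac)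
  finally have energy_aff: "energy r t (aff w) \<le> 2 * (1 + 2 * t) / ((1 - rb) * \<theta>) * K * rb ^ M" .
  have k: "0 < 1 / real M" using M by simp
  note sum = energy_add_le[OF t r(2) smooth(1) aff(1) k]
  have "renorm r t u \<le> (1 + 1 / M) * energy r t (smooth N f) + (1 + M) * energy r t (aff w)"
    using renorm_le[OF t r(2) sum(1) restr] sum(2) by simp
  also have "\<dots> \<le> (1 + 1 / M) * (s ^ (2 * M) * (K + 8 * (1 + t) / \<theta> * K / M))
    + (1 + M) * (2 * (1 + 2 * t) / ((1 - rb) * \<theta>) * K * rb ^ M)"
    using energy_smooth energy_aff by (intro add_mono mult_left_mono) auto
  finally show ?thesis by (simp only: s_def \<theta>_def)
qed

text \<open>M is chosen for unchanged weights, where the error tends to 0, and then \<delta> so that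
  reweighting at most 2 M levels does no harm. The choices use only \<open>ra\<close>,
  \<open>rb\<close>, t, u and \<epsilon>, hence one \<delta> for all pairs r, r'.\<close>

lemma renorm_step:
  assumes t: "0 \<le> t" and ra: "rho < ra" and rb: "rb < 1" and \<epsilon>: "0 < \<epsilon>"
  shows "\<exists>\<delta>>0. \<forall>r r'. ra \<le> r \<longrightarrow> r \<le> r' \<longrightarrow> r' \<le> rb \<longrightarrow> r' - r < \<delta> \<longrightarrow> renorm r t u \<le> renorm r' t u + \<epsilon>"
proof (cases "ra \<le> rb")
  case True
  have ra0: "0 < ra" "0 < rb" "0 \<le> rb" using ra True rho_pos by auto
  define K where "K = renorm ra t u + 1"
  define c1 where "c1 = 8 * (1 + t) / (1 - rho / ra) * K"
  define c2 where "c2 = 2 * (1 + 2 * t) / ((1 - rb) * (1 - rho / ra)) * K"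
  define err where "err d M = (1 + 1 / real M) * ((1 + d / ra) ^ (2 * M) * (K + c1 / M))
    + (1 + real M) * (c2 * rb ^ M) - K" for d M
  have "(\<lambda>M. real M * rb ^ M) \<longlonglongrightarrow> 0"
    using rb ra0 by (intro powser_times_n_limit_0) simp
  moreover have "(\<lambda>M. rb ^ M) \<longlonglongrightarrow> 0" using rb ra0 by (intro LIMSEQ_realpow_zero) auto
  ultimately have "(\<lambda>M. (1 + 1 / real M) * (K + c1 * (1 / real M)) + c2 * (rb ^ M + real M * rb ^ M) - K)
      \<longlonglongrightarrow> (1 + 0) * (K + c1 * 0) + c2 * (0 + 0) - K"
    by (intro tendsto_intros lim_1_over_n) (use rb ra0 in auto)
  then have "(\<lambda>M. err 0 M) \<longlonglongrightarrow> 0" by (simp add: err_def algebra_simps)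
  then have "eventually (\<lambda>M. err 0 M < \<epsilon>) sequentially" using \<epsilon> by (rule order_tendstoD)
  then have "eventually (\<lambda>M. err 0 M < \<epsilon> \<and> 0 < M) sequentially"
    using eventually_gt_at_top[of 0] by eventually_elim simp
  then have "\<exists>M. err 0 M < \<epsilon> \<and> 0 < M" by (rule eventually_happens'[OF sequentially_bot])
  then obtain M where M: "err 0 M < \<epsilon>" "0 < M" by blast
  have "((\<lambda>d. err d M) \<longlongrightarrow> err 0 M) (at 0)"
    unfolding err_def by (intro tendsto_intros) (use ra0 in auto)
  then have "eventually (\<lambda>d. err d M < \<epsilon>) (at 0)" using M(1) by (rule order_tendstoD)
  then obtain \<delta>0 where \<delta>0: "0 < \<delta>0" "\<And>d. d \<noteq> 0 \<Longrightarrow> dist d 0 < \<delta>0 \<Longrightarrow> err d M < \<epsilon>"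
    unfolding eventually_at by auto
  define \<delta> where "\<delta> = \<delta>0 / 2"
  have \<delta>: "0 < \<delta>" "err \<delta> M < \<epsilon>" using \<delta>0 by (auto simp: \<delta>_def)
  have "renorm r t u \<le> renorm r' t u + \<epsilon>" if r: "ra \<le> r" "r \<le> r'" "r' \<le> rb" "r' - r < \<delta>" for r r'
  proof -
    have r0: "0 < r" "rho < r'" "0 < r'" using r ra ra0 by auto
    define s where "s = (r' / r) ^ (2 * M)"
    have "r' / r = 1 + (r' - r) / r" using r0 by (simp add: field_simps)
    also have "(r' - r) / r \<le> \<delta> / ra" using r ra0 \<delta> by (intro frac_le) auto
    finally have "s \<le> (1 + \<delta> / ra) ^ (2 * M)"
      unfolding s_def using r0 by (intro power_mono) auto
    moreover have s1: "1 \<le> s" unfolding s_def using r r0 by (intro one_le_power) auto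
    ultimately have sd: "s \<le> (1 + \<delta> / ra) ^ (2 * M)" by simp
    have K0: "0 \<le> K" using renorm_nonneg[OF t ra, of u] by (simp add: K_def)
    have \<theta>: "0 < 1 - rho / ra" using ra ra0 by simp
    have c1: "0 \<le> c1" unfolding c1_def using K0 t \<theta> by (intro mult_nonneg_nonneg divide_nonneg_pos) auto
    have bound: "renorm r t u \<le> x + \<epsilon>" if x: "renorm r' t u < x" "x \<le> K" for x
    proof -
      obtain f where f: "finite_energy r' t f" "restricts_to f u" "energy r' t f < renorm r' t u + (x - renorm r' t u)"
        using renorm_approx[OF t r0(2), of "x - renorm r' t u" u] x by auto
      have x0: "0 \<le> x" using renorm_nonneg[OF t r0(2), of u] x by simp
      have "renorm r t u \<le> (1 + 1 / M) * (s * (x + 8 * (1 + t) / (1 - rho / ra) * x / M))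
          + (1 + M) * (2 * (1 + 2 * t) / ((1 - rb) * (1 - rho / ra)) * x * rb ^ M)"
        unfolding s_def using f(3)
        by (intro renorm_step_bound[OF t ra r(1-3) rb f(1,2) _ M(2)]) simp
      also have "\<dots> \<le> (1 + 1 / M) * (s * (x + c1 / M)) + (1 + M) * (c2 * rb ^ M)"
        unfolding c1_def c2_def using x x0 t \<theta> rb ra0 s1
        by (intro add_mono mult_left_mono mult_right_mono divide_right_mono) auto
      also have "\<dots> = (1 + 1 / M) * s * x + ((1 + 1 / M) * (s * (c1 / M)) + (1 + M) * (c2 * rb ^ M))"
        by (simp add: distrib_left)
      \<comment> \<open>The factor (1 + 1/M) s is at least 1, so the excess over x increases with x
        and may be evaluated at x = K.\<close>
      also have "(1 + 1 / M) * s * x \<le> (1 + 1 / M) * s * K - (K - x)"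
      proof -
        have "1 * (K - x) \<le> ((1 + 1 / M) * s) * (K - x)"
          using x s1 mult_mono[of 1 "1 + 1 / real M" 1 s] by (intro mult_right_mono) auto
        then have "K - x \<le> (1 + 1 / M) * s * K - (1 + 1 / M) * s * x"
          by (simp only: right_diff_distrib mult_1)
        then show ?thesis by linarith
      qed
      also have "(1 + 1 / M) * s * K - (K - x) + ((1 + 1 / M) * (s * (c1 / M)) + (1 + M) * (c2 * rb ^ M))
          = x + ((1 + 1 / M) * (s * (K + c1 / M)) + (1 + M) * (c2 * rb ^ M) - K)"
        by (simp add: distrib_left)
      also have "(1 + 1 / M) * (s * (K + c1 / M)) + (1 + M) * (c2 * rb ^ M) - K \<le> err \<delta> M"
      proof -
        have "0 \<le> K + c1 / M" "0 \<le> 1 + 1 / real M" using K0 c1 by auto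
        then have "(1 + 1 / M) * (s * (K + c1 / M)) \<le> (1 + 1 / M) * ((1 + \<delta> / ra) ^ (2 * M) * (K + c1 / M))"
          by (intro mult_left_mono mult_right_mono sd)
        then show ?thesis
          unfolding err_def of_nat_add of_nat_1 by (intro diff_right_mono add_right_mono)
      qed
      finally show ?thesis using \<delta>(2) by simp
    qed
    have "renorm r' t u \<le> renorm ra t u" using r by (intro renorm_mono_r t ra) auto
    then have less_K: "renorm r' t u < K" by (simp add: K_def)
    show ?thesis
    proof (rule field_le_epsilon)
      fix \<eta> :: real assume "0 < \<eta>"
      then show "renorm r t u \<le> renorm r' t u + \<epsilon> + \<eta>"
        using bound[of "min K (renorm r' t u + \<eta>)"] less_K by simp
    qed
  qed
  then show ?thesis using \<delta>(1) by blast
qed (auto intro!: exI[of _ 1])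

lemma renorm_continuous_r:
  assumes t: "0 \<le> t" and ra: "rho < ra" and rb: "rb < 1"
  shows "continuous_on {ra..rb} (\<lambda>r. renorm r t u)"
  unfolding continuous_on_iff
proof (intro ballI allI impI)
  fix r \<epsilon> :: real assume r: "r \<in> {ra..rb}" and \<epsilon>: "0 < \<epsilon>"
  obtain \<delta> where \<delta>: "0 < \<delta>"
    "\<And>r r'. ra \<le> r \<Longrightarrow> r \<le> r' \<Longrightarrow> r' \<le> rb \<Longrightarrow> r' - r < \<delta> \<Longrightarrow> renorm r t u \<le> renorm r' t u + \<epsilon> / 2"
    using renorm_step[OF t ra rb, of "\<epsilon> / 2" u] \<epsilon> by auto
  have "dist (renorm r' t u) (renorm r t u) < \<epsilon>" if r': "r' \<in> {ra..rb}" "dist r' r < \<delta>" for r'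
  proof (cases "r \<le> r'")
    case True
    then have "renorm r' t u \<le> renorm r t u" using r ra by (intro renorm_mono_r t) auto
    then show ?thesis using \<delta>(2)[of r r'] r r' True \<epsilon> by (simp add: dist_real_def)
  next
    case False
    then have "renorm r t u \<le> renorm r' t u" using r' ra by (intro renorm_mono_r t) auto
    then show ?thesis using \<delta>(2)[of r' r] r r' False \<epsilon> by (simp add: dist_real_def)
  qed
  then show "\<exists>\<delta>>0. \<forall>r'\<in>{ra..rb}. dist r' r < \<delta> \<longrightarrow> dist (renorm r' t u) (renorm r t u) < \<epsilon>"
    using \<delta>(1) by blast
qed

section \<open>Existence and uniqueness of the scaling factor\<close>

lemma eigenform_sqrt_exists: "\<exists>r t. rho < r \<and> r < 1 \<and> eigenform r t (r\<^sup>2)"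
proof -
  let ?a = "31 / 50 :: real" and ?b = "9 / 10 :: real"
  have a: "rho < ?a" by (rule rho_lt)
  have ex: "\<exists>t l. eigenform r t l" if r: "rho < r" "r < 1" for r
  proof -
    obtain t where "0 \<le> t" "renorm r t u_alt = (1 + 2 * t) * renorm r t u_sym"
      using eigenform_exists[OF r] by blast
    then have "eigenform r t (renorm r t u_sym / 2)" by (simp add: eigenform_def algebra_simps)
    then show ?thesis by blast
  qed
  then obtain T l where e: "\<And>r. rho < r \<Longrightarrow> r < 1 \<Longrightarrow> eigenform r (T r) (l r)" by metis
  \<comment> \<open>The parameter is frozen at \<open>T r\<close> while r' varies: the two bounds of
    \<open>eigenform_min_max\<close> enclose \<open>l r'\<close> between functions continuous in r'
    that meet at \<open>l r\<close> for r' = r.\<close>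
  have cont: "continuous_on {?a..?b} l"
    unfolding continuous_on_def
  proof
    fix r assume r: "r \<in> {?a..?b}"
    let ?t = "T r"
    have er: "0 \<le> ?t" "renorm r ?t u_sym / 2 = l r" "renorm r ?t u_alt / (2 + 4 * ?t) = l r"
      using e[of r] r a by (auto simp: eigenform_def field_simps)
    have "((\<lambda>r'. renorm r' ?t u) \<longlongrightarrow> renorm r ?t u) (at r within {?a..?b})" for u
      using renorm_continuous_r[OF er(1) a, of ?b u] r by (auto simp: continuous_on_def)
    then have "((\<lambda>r'. renorm r' ?t u / c) \<longlongrightarrow> renorm r ?t u / c) (at r within {?a..?b})" if "c \<noteq> 0" for u c
      using that by (intro tendsto_intros)
    from this[of 2 u_sym] this[of "2 + 4 * ?t" u_alt]
    have p: "((\<lambda>r'. renorm r' ?t u_sym / 2) \<longlongrightarrow> l r) (at r within {?a..?b})"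
      and q: "((\<lambda>r'. renorm r' ?t u_alt / (2 + 4 * ?t)) \<longlongrightarrow> l r) (at r within {?a..?b})"
      unfolding er(2,3) using er(1) by auto
    have ev: "eventually (\<lambda>r'. r' \<in> {?a..?b}) (at r within {?a..?b})"
      by (simp add: eventually_at_filter)
    show "(l \<longlongrightarrow> l r) (at r within {?a..?b})"
    proof (rule tendsto_sandwich)
      show "eventually (\<lambda>r'. min (renorm r' ?t u_sym / 2) (renorm r' ?t u_alt / (2 + 4 * ?t)) \<le> l r') (at r within {?a..?b})"
        using ev by eventually_elim (rule eigenform_min_max(1)[OF e _ er(1)]; use a in auto)
      show "eventually (\<lambda>r'. l r' \<le> max (renorm r' ?t u_sym / 2) (renorm r' ?t u_alt / (2 + 4 * ?t))) (at r within {?a..?b})"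
        using ev by eventually_elim (rule eigenform_min_max(2)[OF e _ er(1)]; use a in auto)
      show "((\<lambda>r'. min (renorm r' ?t u_sym / 2) (renorm r' ?t u_alt / (2 + 4 * ?t))) \<longlongrightarrow> l r) (at r within {?a..?b})"
        using tendsto_min[OF p q] by simp
      show "((\<lambda>r'. max (renorm r' ?t u_sym / 2) (renorm r' ?t u_alt / (2 + 4 * ?t))) \<longlongrightarrow> l r) (at r within {?a..?b})"
        using tendsto_max[OF p q] by simp
    qed
  qed
  have "\<exists>r\<ge>?a. r \<le> ?b \<and> l r - r\<^sup>2 = 0"
  proof (rule IVT2')
    have eb: "0 \<le> T ?b" "renorm ?b (T ?b) u_sym = 2 * l ?b" using e[of ?b] a by (auto simp: eigenform_def)
    then show "l ?b - ?b\<^sup>2 \<le> 0" using renorm_upper_end[OF eb(1)] by simp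
    have ea: "0 \<le> T ?a" "renorm ?a (T ?a) u_sym = 2 * l ?a" using e[of ?a] a by (auto simp: eigenform_def)
    \<comment> \<open>The trace increases with t, so the bound at t = 0 covers the unknown parameter
      of the eigenform.\<close>
    then show "0 \<le> l ?a - ?a\<^sup>2"
      using renorm_lower_end renorm_mono_t[OF order_refl ea(1) a, of u_sym] by simp
    show "continuous_on {?a..?b} (\<lambda>r. l r - r\<^sup>2)" by (intro continuous_intros cont)
  qed simp
  then obtain r where "?a \<le> r" "r \<le> ?b" "l r = r\<^sup>2" by auto
  then show ?thesis using e[of r] a by force
qed

lemma solution_iff_eigenform:
  assumes r: "rho < r"
  shows "(\<exists>a. inMS a \<and> (\<forall>u. Rr r a u = r ^ 2 * Dform a u u)) \<longleftrightarrow> (\<exists>t. eigenform r t (r\<^sup>2))"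
proof
  assume "\<exists>a. inMS a \<and> (\<forall>u. Rr r a u = r ^ 2 * Dform a u u)"
  then obtain a where a: "inMS a" "\<And>u. Rr r a u = r ^ 2 * Dform a u u" by blast
  note nf = inMS_normal_form[OF a(1)]
  have "renorm r (a 1 2 / a 0 1) u = r\<^sup>2 * tri_form (a 1 2 / a 0 1) (u 0) (u 1) (u 2)" for u
    using a(2)[of u] nf(1) by (simp add: Rr_normal_form[OF a(1) r] nf(3))
  then show "\<exists>t. eigenform r t (r\<^sup>2)" using eigenform_iff[OF nf(2) r] by blast
next
  assume "\<exists>t. eigenform r t (r\<^sup>2)"
  then obtain t where t: "eigenform r t (r\<^sup>2)" "0 \<le> t" by (auto simp: eigenform_def)
  \<comment> \<open>Vertex 0 is joined to both others, so the form is irreducible even if t =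
    0.\<close>
  define a :: "nat \<Rightarrow> nat \<Rightarrow> real" where "a i j = (if i = j then 0 else if i = 0 \<or> j = 0 then 1 else t)" for i j
  have irr: "irreducible3 a"
    unfolding irreducible3_def
  proof
    assume "\<exists>S. S \<noteq> {} \<and> S \<subset> {0, 1, 2} \<and> (\<forall>i\<in>S. \<forall>j\<in>{0, 1, 2} - S. a i j = 0)"
    then obtain S where S: "S \<noteq> {}" "S \<subset> {0, 1, 2}" and zero: "\<forall>i\<in>S. \<forall>j\<in>{0, 1, 2} - S. a i j = 0"
      by (elim exE conjE)
    obtain i where i: "i \<in> S" using S(1) by auto
    obtain j where j: "j \<in> {0, 1, 2} - S" using psubset_imp_ex_mem[OF S(2)] by auto
    show False
    proof (cases "0 \<in> S")
      case True
      then have "a 0 j = 0" "j \<noteq> 0" using zero j by auto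
      then show False by (simp add: a_def)
    next
      case False
      then have "0 \<in> {0, 1, 2} - S" by simp
      then have "a i 0 = 0" using zero i False by auto
      moreover have "i \<noteq> 0" using i False by metis
      ultimately show False by (simp add: a_def)
    qed
  qed
  then have a: "inMS a" using t(2) by (auto simp: inMS_def inM_def a_def)
  have vals: "a 0 1 = 1" "a 1 2 = t" by (simp_all add: a_def)
  have "Rr r a u = r\<^sup>2 * Dform a u u" for u
    using t eigenform_iff[OF t(2) r] inMS_normal_form(3)[OF a] Rr_normal_form[OF a r]
    unfolding vals by simp
  then show "\<exists>a. inMS a \<and> (\<forall>u. Rr r a u = r ^ 2 * Dform a u u)" using a by blast
qed

theorem theorem5p7:
  shows "\<exists>!r. rho < r \<and> r < 1 \<and>
           (\<exists>a. inMS a \<and> (\<forall>u. Rr r a u = r ^ 2 * Dform a u u))"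
proof (rule ex_ex1I)
  show "\<exists>r. rho < r \<and> r < 1 \<and> (\<exists>a. inMS a \<and> (\<forall>u. Rr r a u = r ^ 2 * Dform a u u))"
  proof -
    obtain r t where r: "rho < r" "r < 1" and "eigenform r t (r\<^sup>2)"
      using eigenform_sqrt_exists by blast
    then have "\<exists>a. inMS a \<and> (\<forall>u. Rr r a u = r ^ 2 * Dform a u u)"
      unfolding solution_iff_eigenform[OF r(1)] by blast
    with r show ?thesis by (intro exI[of _ r] conjI)
  qed
next
  \<comment> \<open>The eigenvalues r^2 and r'^2 are ordered opposite to r and r', and squaring
    preserves the order of positive numbers.\<close>
  have le: "r' \<le> r" if "rho < r" "r \<le> r'" "eigenform r t (r\<^sup>2)" "eigenform r' t' (r'\<^sup>2)" for r r' t t'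
    using that(1) rho_pos by (intro power2_le_imp_le[OF eigenform_mono_r[OF that(3,4,1,2)]]) simp
  fix r r'
  assume r: "rho < r \<and> r < 1 \<and> (\<exists>a. inMS a \<and> (\<forall>u. Rr r a u = r ^ 2 * Dform a u u))"
    and r': "rho < r' \<and> r' < 1 \<and> (\<exists>a. inMS a \<and> (\<forall>u. Rr r' a u = r' ^ 2 * Dform a u u))"
  obtain t where t: "eigenform r t (r\<^sup>2)"
    using exE[OF solution_iff_eigenform[THEN iffD1, OF conjunct1[OF r] conjunct2[OF conjunct2[OF r]]]] .
  obtain t' where t': "eigenform r' t' (r'\<^sup>2)"
    using exE[OF solution_iff_eigenform[THEN iffD1, OF conjunct1[OF r'] conjunct2[OF conjunct2[OF r']]]] .
  show "r = r'"
  proof (cases "r \<le> r'")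
    case True
    then show ?thesis using le[OF conjunct1[OF r] True t t'] by simp
  next
    case False
    then show ?thesis using le[OF conjunct1[OF r'] _ t' t] by simp
  qed
qed

end
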